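(* Let $d=1$, $\mu>-\frac12$, $\beta>-1$, $\gamma>-1$ with $2\mu+\beta+1>0$, and $n\ge0$. Define the polynomials $\{\mathsf{Y}^{\mathsf J}_{n-k,n}:0\le k\le n\}$ recursively as follows: for $k=0,1$ (with $k\le n$), $\mathsf{Y}^{\mathsf J}_{n-k,n}=\mathsf{U}^{\mathsf J}_{n-k,n}$, and for $k=2,3,\ldots,n$, $$\mathsf{Y}^{\mathsf J}_{n-k,n}(x,t)=\mathsf{U}^{\mathsf J}_{n-k,n}(x,t)-\sum_{1\le i\le\lfloor k/2\rfloor}d_{i,k}\,\mathsf{Y}^{\mathsf J}_{n-k+2i,n}(x,t),$$ where $$d_{i,k}=\frac{k!\,(\mu+i+n-k+1)_i\,(\gamma+k-2i+1)_{2i}}{2^{2i}(k-2i)!\,i!\,(\mu+n-k+\frac12)_{2i}\,(2\mu+\beta+2n-k+1)_{2i}}.$$ Then $\{\mathsf{Y}^{\mathsf J}_{n-k,n}:0\le k\le n\}$ is a basis of $\mathcal{V}_n(\mathbb{V}^2,W_{\beta,\gamma,\mu})$ and it is mutually biorthogonal to the basis $\{\mathsf{V}^{\mathsf J}_{k,n}:0\le k\le n\}$, i.e. $\int_{\mathbb{V}^2}\mathsf{Y}^{\mathsf J}_{k,n}\mathsf{V}^{\mathsf J}_{j,n}W_{\beta,\gamma,\mu}\,dx\,dt$ is zero if $k\ne j$ and nonzero if $k=j$.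
   Context: $\mathbb{V}^2=\{(x,t)\in\mathbb{R}^2:|x|\le t,\ 0\le t\le1\}$, $W_{\beta,\gamma,\mu}(x,t)=(t^2-x^2)^{\mu-\frac12}t^\beta(1-t)^\gamma$. $\mathcal{V}_n(\mathbb{V}^2,W_{\beta,\gamma,\mu})$ is the space of polynomials of degree at most $n$ in $(x,t)$ orthogonal to all polynomials of degree at most $n-1$ with respect to $\int_{\mathbb{V}^2}fg\,W_{\beta,\gamma,\mu}\,dx\,dt$. $(a)_k=a(a+1)\cdots(a+k-1)$. For $0\le k\le n$, $$\mathsf{U}^{\mathsf J}_{k,n}(x,t)=\frac{1}{W_{\beta,\gamma,\mu}(x,t)}\,\frac{1}{t^{2k+2\mu}}\left[\frac{\partial^{k}}{\partial x^{k}}(t^2-x^2)^{k+\mu-\frac12}\right]\left[\frac{\partial^{n-k}}{\partial t^{n-k}}\bigl(t^{n+k+\beta+2\mu}(1-t)^{\gamma+n-k}\bigr)\right],$$ and $\mathsf{V}^{\mathsf J}_{k,n}$ is the unique element of $\mathcal{V}_n(\mathbb{V}^2,W_{\beta,\gamma,\mu})$ such that $\mathsf{V}^{\mathsf J}_{k,n}(x,t)-t^{n-k}x^k$ is a polynomial of degree at most $n-1$. *)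

theory Defs
  imports "HOL-Analysis.Analysis" "HOL-Library.Function_Algebras"
begin

text \<open>
  A polynomial in the two variables \<open>(x, t)\<close> is represented by the function it induces on the
  plane (the real field is infinite, so nothing is lost). The real vector space of functions on
  the plane, with pointwise operations, supplies spans and linear independence.
\<close>

interpretation fun_vs: vector_space "\<lambda>(c::real) (f :: real \<times> real \<Rightarrow> real) p. c * f p"
  by unfold_locales (auto simp: fun_eq_iff algebra_simps)

definition monomial_xt :: "nat \<Rightarrow> nat \<Rightarrow> real \<times> real \<Rightarrow> real" where
  "monomial_xt i j = (\<lambda>(x, t). x ^ i * t ^ j)"

definition polys_le :: "nat \<Rightarrow> (real \<times> real \<Rightarrow> real) set" where
  "polys_le n = fun_vs.span {monomial_xt i j | i j. i + j \<le> n}"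

text \<open>Polynomials of degree at most \<open>n - 1\<close>; for \<open>n = 0\<close> only the zero polynomial.\<close>

definition polys_less :: "nat \<Rightarrow> (real \<times> real \<Rightarrow> real) set" where
  "polys_less n = fun_vs.span {monomial_xt i j | i j. i + j < n}"

definition cone2 :: "(real \<times> real) set" where
  "cone2 = {(x, t). \<bar>x\<bar> \<le> t \<and> 0 \<le> t \<and> t \<le> 1}"

definition jacobi_weight :: "real \<Rightarrow> real \<Rightarrow> real \<Rightarrow> real \<times> real \<Rightarrow> real" where
  "jacobi_weight \<beta> \<gamma> \<mu> =
     (\<lambda>(x, t). (t\<^sup>2 - x\<^sup>2) powr (\<mu> - 1/2) * t powr \<beta> * (1 - t) powr \<gamma>)"

definition jacobi_ip ::
  "real \<Rightarrow> real \<Rightarrow> real \<Rightarrow> (real \<times> real \<Rightarrow> real) \<Rightarrow> (real \<times> real \<Rightarrow> real) \<Rightarrow> real" where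
  "jacobi_ip \<beta> \<gamma> \<mu> f g = (LINT p:cone2|lborel. f p * g p * jacobi_weight \<beta> \<gamma> \<mu> p)"

definition orth_polys :: "real \<Rightarrow> real \<Rightarrow> real \<Rightarrow> nat \<Rightarrow> (real \<times> real \<Rightarrow> real) set" where
  "orth_polys \<beta> \<gamma> \<mu> n =
     {f \<in> polys_le n. \<forall>g \<in> polys_less n. jacobi_ip \<beta> \<gamma> \<mu> f g = 0}"

definition rodrigues_U ::
  "real \<Rightarrow> real \<Rightarrow> real \<Rightarrow> nat \<Rightarrow> nat \<Rightarrow> real \<times> real \<Rightarrow> real" where
  "rodrigues_U \<beta> \<gamma> \<mu> k n = (\<lambda>(x, t).
     1 / jacobi_weight \<beta> \<gamma> \<mu> (x, t) * (1 / t powr (2 * real k + 2 * \<mu>))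
     * (deriv ^^ k) (\<lambda>y. (t\<^sup>2 - y\<^sup>2) powr (real k + \<mu> - 1/2)) x
     * (deriv ^^ (n - k))
         (\<lambda>s. s powr (real n + real k + \<beta> + 2 * \<mu>) * (1 - s) powr (\<gamma> + real n - real k)) t)"

text \<open>
  The Rodrigues formula makes sense only in the interior of the cone, where the weight is positive
  and finite. The polynomial U is the one whose values there are given by the formula; a polynomial
  is determined by its values on that open set.
\<close>

definition U_poly ::
  "real \<Rightarrow> real \<Rightarrow> real \<Rightarrow> nat \<Rightarrow> nat \<Rightarrow> real \<times> real \<Rightarrow> real" where
  "U_poly \<beta> \<gamma> \<mu> k n =
     (THE f. (\<exists>m. f \<in> polys_le m) \<and> (\<forall>p \<in> interior cone2. f p = rodrigues_U \<beta> \<gamma> \<mu> k n p))"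

definition V_poly ::
  "real \<Rightarrow> real \<Rightarrow> real \<Rightarrow> nat \<Rightarrow> nat \<Rightarrow> real \<times> real \<Rightarrow> real" where
  "V_poly \<beta> \<gamma> \<mu> k n =
     (THE f. f \<in> orth_polys \<beta> \<gamma> \<mu> n \<and> f - monomial_xt k (n - k) \<in> polys_less n)"

definition d_coeff :: "real \<Rightarrow> real \<Rightarrow> real \<Rightarrow> nat \<Rightarrow> nat \<Rightarrow> nat \<Rightarrow> real" where
  "d_coeff \<beta> \<gamma> \<mu> n i k =
     (fact k * pochhammer (\<mu> + real i + real n - real k + 1) i
             * pochhammer (\<gamma> + real k - 2 * real i + 1) (2 * i))
     / (2 ^ (2 * i) * fact (k - 2 * i) * fact i
             * pochhammer (\<mu> + real n - real k + 1/2) (2 * i)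
             * pochhammer (2 * \<mu> + \<beta> + 2 * real n - real k + 1) (2 * i))"

text \<open>
  The recursion is indexed by \<open>m = n - k\<close>; lemmas \<open>Y_poly_init\<close> and \<open>Y_poly_step\<close> restate it in
  terms of \<open>k\<close>. Indices \<open>m > n\<close> carry no meaning.
\<close>

function Y_poly ::
  "real \<Rightarrow> real \<Rightarrow> real \<Rightarrow> nat \<Rightarrow> nat \<Rightarrow> real \<times> real \<Rightarrow> real" where
  "Y_poly \<beta> \<gamma> \<mu> m n =
     (if n - m < 2 then U_poly \<beta> \<gamma> \<mu> m n
      else (\<lambda>p. U_poly \<beta> \<gamma> \<mu> m n p
             - (\<Sum>i = 1..(n - m) div 2. d_coeff \<beta> \<gamma> \<mu> n i (n - m) * Y_poly \<beta> \<gamma> \<mu> (m + 2 * i) n p)))"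
  by pat_completeness auto
termination
  by (relation "Wellfounded.measure (\<lambda>(\<beta>, \<gamma>, \<mu>, m, n). n - m)") auto

declare Y_poly.simps [simp del]

lemma Y_poly_init:
  assumes "k \<le> n" "k = 0 \<or> k = 1"
  shows "Y_poly \<beta> \<gamma> \<mu> (n - k) n = U_poly \<beta> \<gamma> \<mu> (n - k) n"
  using assms by (subst Y_poly.simps) auto

lemma Y_poly_step:
  assumes "2 \<le> k" "k \<le> n"
  shows "Y_poly \<beta> \<gamma> \<mu> (n - k) n =
    (\<lambda>p. U_poly \<beta> \<gamma> \<mu> (n - k) n p
       - (\<Sum>i = 1..k div 2. d_coeff \<beta> \<gamma> \<mu> n i k * Y_poly \<beta> \<gamma> \<mu> (n - k + 2 * i) n p))"
  using assms by (subst Y_poly.simps) auto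

definition is_basis_family ::
  "nat set \<Rightarrow> (nat \<Rightarrow> real \<times> real \<Rightarrow> real) \<Rightarrow> (real \<times> real \<Rightarrow> real) set \<Rightarrow> bool" where
  "is_basis_family I b S \<longleftrightarrow>
     inj_on b I \<and> fun_vs.independent (b ` I) \<and> fun_vs.span (b ` I) = S"

end

theory Submission
  imports Defs
begin

text \<open>
  The substitution \<open>x = t u\<close> turns the moments of the weight into products of one-dimensional
  moments of \<open>(1 - u\<^sup>2)\<close> and \<open>t, 1 - t\<close> powers, and \<open>U\<^sub>k\<^sub>,\<^sub>n\<close> into a product of two univariate
  Rodrigues polynomials. Integration by parts in each variable shows that \<open>U\<^sub>k\<^sub>,\<^sub>n\<close> is orthogonal to
  lower degree, that its moment against \<open>x\<^sup>j t\<^sup>n\<^sup>-\<^sup>j\<close> vanishes unless \<open>j = k + 2i\<close> with \<open>i \<ge> 0\<close>, and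
  that this moment is then \<open>d\<^sub>i\<^sub>,\<^sub>n\<^sub>-\<^sub>k\<close> times the diagonal moment of index \<open>j\<close>. The recursion
  defining \<open>Y\<close> therefore eliminates exactly the off-diagonal moments. As \<open>V\<^sub>j\<^sub>,\<^sub>n\<close> differs from
  \<open>x\<^sup>j t\<^sup>n\<^sup>-\<^sup>j\<close> by lower degree, \<open>Y\<close> and \<open>V\<close> are biorthogonal, and since the \<open>V\<close> span, both families
  are bases.
\<close>

subsection \<open>Univariate Rodrigues polynomials\<close>

text \<open>The recursion is the product rule for
  \<open>(s - l)\<^sup>p\<^sup>-\<^sup>i (r - s)\<^sup>q\<^sup>-\<^sup>i R\<^sub>i(s)\<close>, the \<open>i\<close>-th derivative of \<open>(s - l)\<^sup>p (r - s)\<^sup>q\<close>.\<close>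

primrec rodrigues_poly :: "real \<Rightarrow> real \<Rightarrow> real \<Rightarrow> real \<Rightarrow> nat \<Rightarrow> real poly" where
  "rodrigues_poly l r p q 0 = 1"
| "rodrigues_poly l r p q (Suc i) =
     [:-l, 1:] * [:r, -1:] * pderiv (rodrigues_poly l r p q i)
     + ([:(p - real i) * r, -(p - real i):] + [:(q - real i) * l, -(q - real i):])
         * rodrigues_poly l r p q i"

lemma degree_rodrigues_poly: "degree (rodrigues_poly l r p q i) \<le> i"
proof (induction i)
  case (Suc i)
  let ?R = "rodrigues_poly l r p q i"
  have "degree ([:-l, 1:] * [:r, -1:] * pderiv ?R) \<le> Suc i"
  \<comment> \<open>The quadratic factor adds 2 and the derivative takes 1 away. With truncated
    subtraction the second half fails for a constant \<open>?R\<close>, where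
    \<open>pderiv ?R = 0\<close> is used instead.\<close>
  proof (cases "degree ?R = 0")
    case True
    then show ?thesis by (simp add: pderiv_eq_0_iff[THEN iffD2, OF True])
  next
    case False
    have "degree ([:-l, 1:] * [:r, -1:] * pderiv ?R) \<le> 2 + degree (pderiv ?R)"
      by (rule order.trans[OF degree_mult_le add_mono[OF order.trans[OF degree_mult_le]]]) auto
    also have "\<dots> \<le> 2 + (degree ?R - 1)"
      by (simp add: degree_pderiv)
    finally show ?thesis using False Suc by linarith
  qed
  moreover have "degree (([:(p - real i) * r, -(p - real i):] + [:(q - real i) * l, -(q - real i):]) * ?R) \<le> Suc i"
    by (rule order.trans[OF degree_mult_le]) (use Suc in auto)
  ultimately show ?case by (simp add: degree_add_le del: mult_pCons_left mult_pCons_right add_pCons)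
qed simp

text \<open>Homogeneity: under scaling by \<open>t\<close> the quadratic factor of the recursion
  gains \<open>t^2\<close>, the derivative \<open>1/t\<close> and the linear factor
  \<open>t\<close>, so each step contributes one factor \<open>t\<close>. This reduces the interval
  \<open>(-t, t)\<close> of the variable \<open>x\<close> to the fixed interval
  \<open>(-1, 1)\<close>.\<close>

lemma rodrigues_poly_scale:
  assumes "t \<noteq> 0"
  shows "rodrigues_poly (t * l) (t * r) p q i
    = smult (t ^ i) (pcompose (rodrigues_poly l r p q i) [:0, 1/t:])"
proof (induction i)
  case (Suc i)
  let ?R = "rodrigues_poly l r p q i"
  have p: "poly (rodrigues_poly (t * l) (t * r) p q i) x = t ^ i * poly ?R (x / t)" for x
    by (simp add: Suc poly_pcompose)
  have d: "t * poly (pderiv (rodrigues_poly (t * l) (t * r) p q i)) x = t ^ i * poly (pderiv ?R) (x / t)" for x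
    using assms by (simp add: Suc pderiv_smult pderiv_pcompose poly_pcompose pderiv_pCons)
  have "poly (rodrigues_poly (t * l) (t * r) p q (Suc i)) x =
    poly (smult (t ^ Suc i) (pcompose (rodrigues_poly l r p q (Suc i)) [:0, 1/t:])) x" for x
  proof -
    define y where "y = x / t"
    then have x: "x = t * y" using assms by simp
    have "poly (rodrigues_poly (t * l) (t * r) p q (Suc i)) x =
      t * (y - l) * (r - y) * (t * poly (pderiv (rodrigues_poly (t * l) (t * r) p q i)) x)
      + t * ((p - real i) * (r - y) + (q - real i) * (l - y)) * poly (rodrigues_poly (t * l) (t * r) p q i) x"
      by (simp add: x algebra_simps)
    also have "\<dots> = t ^ Suc i * poly (rodrigues_poly l r p q (Suc i)) y"
      unfolding p d y_def[symmetric] by (simp add: algebra_simps)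
    finally show ?thesis by (simp add: poly_pcompose y_def del: rodrigues_poly.simps)
  qed
  then show ?case by (intro poly_eq_poly_eq_iff[THEN iffD1] ext)
qed (simp add: pcompose_1)

lemma DERIV_rodrigues:
  fixes l r s p q :: real
  assumes "l < s" "s < r"
  shows "((\<lambda>s. (s - l) powr (p - real i) * (r - s) powr (q - real i) * poly (rodrigues_poly l r p q i) s)
    has_real_derivative (s - l) powr (p - real (Suc i)) * (r - s) powr (q - real (Suc i))
      * poly (rodrigues_poly l r p q (Suc i)) s) (at s)"
proof -
  let ?R = "rodrigues_poly l r p q i"
  have a: "((\<lambda>s. (s - l) powr (p - real i)) has_real_derivative (p - real i) * (s - l) powr (p - real i - 1)) (at s)"
    using assms by (intro DERIV_cong[OF DERIV_fun_powr[where g="\<lambda>s. s - l" and m=1]]) (auto intro!: derivative_eq_intros)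
  have b: "((\<lambda>s. (r - s) powr (q - real i)) has_real_derivative - ((q - real i) * (r - s) powr (q - real i - 1))) (at s)"
    using assms by (intro DERIV_cong[OF DERIV_fun_powr[where g="\<lambda>s. r - s" and m="-1"]]) (auto intro!: derivative_eq_intros)
  \<comment> \<open>Splitting off one power brings all three terms of the product rule to the
    exponents \<open>p - Suc i\<close> and \<open>q - Suc i\<close>; what remains is the
    recursion.\<close>
  have e1: "(s - l) powr (p - real i) = (s - l) * (s - l) powr (p - real (Suc i))"
    using assms powr_add[of "s - l" 1 "p - real (Suc i)"] by simp
  have e2: "(r - s) powr (q - real i) = (r - s) * (r - s) powr (q - real (Suc i))"
    using assms powr_add[of "r - s" 1 "q - real (Suc i)"] by simp
  have e3: "p - real i - 1 = p - real (Suc i)" "q - real i - 1 = q - real (Suc i)" by auto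
  show ?thesis
    by (rule DERIV_cong[OF DERIV_mult[OF DERIV_mult[OF a b] poly_DERIV]])
      (simp only: e3, simp add: e1 e2 algebra_simps del: of_nat_Suc)
qed

lemma higher_deriv_rodrigues:
  fixes l r s p q :: real
  assumes "l < s" "s < r" and f: "\<And>s. l < s \<Longrightarrow> s < r \<Longrightarrow> f s = (s - l) powr p * (r - s) powr q"
  shows "(deriv ^^ i) f s = (s - l) powr (p - real i) * (r - s) powr (q - real i)
    * poly (rodrigues_poly l r p q i) s"
  using assms(1,2)
proof (induction i arbitrary: s)
  case (Suc i)
  \<comment> \<open>Differentiating once more requires the formula in a whole neighbourhood, so the
    induction hypothesis is used on the open interval.\<close>
  have "eventually (\<lambda>s. s \<in> {l<..<r}) (nhds s)"
    using Suc.prems by (intro eventually_nhds_in_open) auto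
  then have "eventually (\<lambda>s. (deriv ^^ i) f s = (s - l) powr (p - real i) * (r - s) powr (q - real i)
    * poly (rodrigues_poly l r p q i) s) (nhds s)"
    by eventually_elim (use Suc.IH in auto)
  from deriv_cong_ev[OF this refl] show ?case
    using DERIV_imp_deriv[OF DERIV_rodrigues[OF Suc.prems, of p i q]] by simp
qed (simp add: f)

section \<open>Repeated integration by parts against Rodrigues polynomials\<close>

lemma continuous_on_jacobi_density:
  fixes l r p q :: real
  assumes "p > 0" "q > 0"
  shows "continuous_on {l..r} (\<lambda>s. (s - l) powr p * (r - s) powr q)"
  using assms by (intro continuous_on_mult continuous_on_powr' continuous_intros) auto

text \<open>One integration by parts, since \<open>F (Suc i)\<close> is the derivative of
  \<open>F i\<close> in the open interval. The positive exponents make \<open>F i\<close> continuous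
  up to the endpoints, where it vanishes, so no boundary term survives.\<close>

lemma rodrigues_parts_step:
  fixes l r p q :: real
  assumes "l \<le> r" "p > real i" "q > real i"
  defines "F \<equiv> \<lambda>i s. (s - l) powr (p - real i) * (r - s) powr (q - real i) * poly (rodrigues_poly l r p q i) s"
  assumes "((\<lambda>s. poly (pderiv f) s * F i s) has_integral I) {l..r}"
  shows "((\<lambda>s. poly f s * F (Suc i) s) has_integral - I) {l..r}"
proof -
  have "((\<lambda>s. poly (pderiv f) s * F i s + poly f s * F (Suc i) s) has_integral
      (poly f r * F i r - poly f l * F i l)) {l..r}"
  proof (rule fundamental_theorem_of_calculus_interior)
    show "continuous_on {l..r} (\<lambda>x. poly f x * F i x)"
      unfolding F_def using assms by (intro continuous_intros continuous_on_jacobi_density) auto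
    fix x assume "x \<in> {l<..<r}"
    then have "(F i has_real_derivative F (Suc i) x) (at x)"
      unfolding F_def by (intro DERIV_rodrigues) auto
    from DERIV_mult[OF poly_DERIV[of f x] this]
    have "((\<lambda>x. poly f x * F i x) has_real_derivative (poly (pderiv f) x * F i x + poly f x * F (Suc i) x)) (at x)"
      by (simp add: algebra_simps)
    then show "((\<lambda>x. poly f x * F i x) has_vector_derivative (poly (pderiv f) x * F i x + poly f x * F (Suc i) x)) (at x)"
      by (simp add: has_real_derivative_iff_has_vector_derivative)
  qed fact
  also have "poly f r * F i r - poly f l * F i l = 0"
    by (simp add: F_def)
  finally show ?thesis
    using has_integral_diff[OF _ assms(5)] by fastforce
qed

text \<open>The last of the \<open>i\<close> steps starts from the exponents
  \<open>p - (i - 1)\<close> and \<open>q - (i - 1)\<close>, which must be positive; the final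
  exponents may therefore be negative, as long as they exceed -1.\<close>

lemma rodrigues_parts:
  fixes l r p q :: real
  assumes "l \<le> r" "p > real i - 1" "q > real i - 1"
    and "((\<lambda>s. poly ((pderiv ^^ i) f) s * ((s - l) powr p * (r - s) powr q)) has_integral I) {l..r}"
  shows "((\<lambda>s. poly f s * ((s - l) powr (p - real i) * (r - s) powr (q - real i)
    * poly (rodrigues_poly l r p q i) s)) has_integral (-1) ^ i * I) {l..r}"
  using assms(2-)
proof (induction i arbitrary: f)
  case (Suc i)
  have "((\<lambda>s. poly (pderiv f) s * ((s - l) powr (p - real i) * (r - s) powr (q - real i)
    * poly (rodrigues_poly l r p q i) s)) has_integral (-1) ^ i * I) {l..r}"
    using Suc.prems by (intro Suc.IH) (simp_all add: funpow_Suc_right del: funpow.simps)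
  from rodrigues_parts_step[OF assms(1) _ _ this] show ?case using Suc.prems by simp
qed simp

lemma higher_pderiv_monom:
  "(pderiv ^^ i) (monom (1::real) j) = (if i \<le> j then monom (fact j / fact (j - i)) (j - i) else 0)"
proof (induction i)
  case (Suc i)
  show ?case
  proof (cases "Suc i \<le> j")
    case True
    then have "(fact (j - i) :: real) = real (j - i) * fact (j - Suc i)"
      using fact_reduce[of "j - i", where 'a=real] by simp
    then show ?thesis using True Suc by (simp add: pderiv_monom)
  next
    case False
    then consider "i = j" | "i > j" by linarith
    then show ?thesis by cases (use Suc False in \<open>auto simp: pderiv_monom\<close>)
  qed
qed simp

subsection \<open>Moments of the weight on the cone\<close>

text \<open>The affine map of \<open>{l..r}\<close> onto \<open>{0..1}\<close> turns the density
  into a multiple of the Beta integrand; the continuous factor \<open>f\<close> is bounded on the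
  compact interval.\<close>

lemma set_integrable_jacobi_density:
  fixes l r p q :: real
  assumes "l < r" "p > -1" "q > -1" and f: "continuous_on UNIV f"
  shows "set_integrable lborel {l..r} (\<lambda>s. f s * ((s - l) powr p * (r - s) powr q))"
proof -
  have "integrable lborel (\<lambda>s. indicator {0..1} s *\<^sub>R (s powr p * (1 - s) powr q))"
    using integrable_Beta[of "p + 1" "q + 1"] assms by (simp add: set_integrable_def)
  then have "integrable lborel (\<lambda>s. (r - l) powr p * (r - l) powr q *
      (indicator {0..1} (- l / (r - l) + 1 / (r - l) * s) *\<^sub>R ((- l / (r - l) + 1 / (r - l) * s) powr p
        * (1 - (- l / (r - l) + 1 / (r - l) * s)) powr q)))"
    using assms by (intro integrable_mult_right lborel_integrable_real_affine
        [where f="\<lambda>s. indicator {0..1} s *\<^sub>R (s powr p * (1 - s) powr q)"]) auto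
  also have "(\<lambda>s. (r - l) powr p * (r - l) powr q *
      (indicator {0..1} (- l / (r - l) + 1 / (r - l) * s) *\<^sub>R ((- l / (r - l) + 1 / (r - l) * s) powr p
        * (1 - (- l / (r - l) + 1 / (r - l) * s)) powr q)))
    = (\<lambda>s. indicator {l..r} s *\<^sub>R ((s - l) powr p * (r - s) powr q))"
  proof
    fix s
    have a: "- l / (r - l) + 1 / (r - l) * s = (s - l) / (r - l)"
      by (simp add: diff_divide_distrib)
    have b: "1 - (s - l) / (r - l) = (r - s) / (r - l)"
      using assms by (simp add: field_simps)
    have c: "(s - l) / (r - l) \<in> {0..1} \<longleftrightarrow> s \<in> {l..r}"
      using assms by (simp add: field_simps)
    show "(r - l) powr p * (r - l) powr q *
      (indicator {0..1} (- l / (r - l) + 1 / (r - l) * s) *\<^sub>R ((- l / (r - l) + 1 / (r - l) * s) powr p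
        * (1 - (- l / (r - l) + 1 / (r - l) * s)) powr q))
      = indicator {l..r} s *\<^sub>R ((s - l) powr p * (r - s) powr q)"
      unfolding a b using assms c by (auto simp: indicator_def powr_divide)
  qed
  finally have I: "integrable lborel (\<lambda>s. indicator {l..r} s *\<^sub>R ((s - l) powr p * (r - s) powr q))" .
  have "compact (f ` {l..r})"
    using f by (intro compact_continuous_image continuous_on_subset[OF f]) auto
  then obtain B where "\<forall>y\<in>f ` {l..r}. norm y \<le> B"
    using compact_imp_bounded bounded_iff by metis
  then have B: "\<And>s. s \<in> {l..r} \<Longrightarrow> \<bar>f s\<bar> \<le> B"
    by auto
  have [measurable]: "f \<in> borel_measurable borel"
    using f by (rule borel_measurable_continuous_onI)
  show ?thesis
    unfolding set_integrable_def
  proof (rule Bochner_Integration.integrable_bound[OF integrable_mult_right[OF I, of B]])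
    show "AE s in lborel. norm (indicator {l..r} s *\<^sub>R (f s * ((s - l) powr p * (r - s) powr q)))
      \<le> norm (B * (indicator {l..r} s *\<^sub>R ((s - l) powr p * (r - s) powr q)))"
    proof (intro AE_I2)
      fix s
      show "norm (indicator {l..r} s *\<^sub>R (f s * ((s - l) powr p * (r - s) powr q)))
      \<le> norm (B * (indicator {l..r} s *\<^sub>R ((s - l) powr p * (r - s) powr q)))"
        using B[of s] by (auto simp: indicator_def abs_mult intro!: mult_right_mono)
    qed
  qed measurable
qed

lemma jacobi_density_integrable_on:
  fixes l r p q :: real
  assumes "l < r" "p > -1" "q > -1" and "continuous_on UNIV f"
  shows "(\<lambda>s. f s * ((s - l) powr p * (r - s) powr q)) integrable_on {l..r}"
  using set_borel_integral_eq_integral(1)[OF set_integrable_jacobi_density[OF assms]] .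

text \<open>Moments of \<open>(1 - u^2)^c\<close>, with the weight split as \<open>(s - l)\<close>,
  \<open>(r - s)\<close> for \<open>l = -1\<close>, \<open>r = 1\<close> so that the integration by
  parts lemmas match syntactically.\<close>

definition gegenbauer_moment :: "real \<Rightarrow> nat \<Rightarrow> real" where
  "gegenbauer_moment c e = integral {-1..1} (\<lambda>u. u ^ e * ((u - -1) powr c * (1 - u) powr c))"

text \<open>The exponent \<open>2 \<mu> + \<beta>\<close> collects \<open>2 \<mu> - 1\<close> from
  \<open>(t^2 - x^2)\<close> under \<open>x = t u\<close>, \<beta> from the weight and 1 from
  \<open>dx = t du\<close>.\<close>

definition t_moment :: "real \<Rightarrow> real \<Rightarrow> real \<Rightarrow> nat \<Rightarrow> real" where
  "t_moment \<beta> \<gamma> \<mu> b = integral {0..1} (\<lambda>t. t ^ b * ((t - 0) powr (2 * \<mu> + \<beta>) * (1 - t) powr \<gamma>))"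

lemma closed_cone2: "closed cone2"
proof -
  have "cone2 = {p. \<bar>fst p\<bar> \<le> snd p} \<inter> {p. 0 \<le> snd p} \<inter> {p. snd p \<le> 1}"
    by (auto simp: cone2_def)
  also have "closed \<dots>"
    by (intro closed_Int closed_Collect_le continuous_intros)
  finally show ?thesis .
qed

lemma cone2_borel [measurable]: "cone2 \<in> sets borel"
  using closed_cone2 by (rule borel_closed)

lemma jacobi_weight_measurable [measurable]: "jacobi_weight \<beta> \<gamma> \<mu> \<in> borel_measurable borel"
proof -
  have "(\<lambda>p::real \<times> real. ((snd p)\<^sup>2 - (fst p)\<^sup>2) powr (\<mu> - 1/2) * snd p powr \<beta> * (1 - snd p) powr \<gamma>)
      \<in> borel_measurable (borel \<Otimes>\<^sub>M borel)"
    by measurable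
  then show ?thesis by (simp add: jacobi_weight_def case_prod_beta' borel_prod)
qed

lemma continuous_on_monomial_xt: "continuous_on UNIV (monomial_xt i j)"
  unfolding monomial_xt_def case_prod_beta' by (intro continuous_intros)

lemma monomial_xt_measurable [measurable]: "monomial_xt i j \<in> borel_measurable borel"
  by (rule borel_measurable_continuous_onI[OF continuous_on_monomial_xt])

text \<open>On the slice at height \<open>t\<close> the substitution \<open>x = t u\<close>
  separates the integrand into \<open>K t\<close> times \<open>P u\<close>; Fubini then gives
  integrability and the product value together.\<close>

lemma has_bochner_integral_cone_moment:
  fixes \<beta> \<gamma> \<mu> :: real
  assumes "\<mu> > -1/2" "\<gamma> > -1" "2 * \<mu> + \<beta> + 1 > 0"
  shows "has_bochner_integral lborel
    (\<lambda>p. indicator cone2 p *\<^sub>R (monomial_xt a b p * jacobi_weight \<beta> \<gamma> \<mu> p))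
    (gegenbauer_moment (\<mu> - 1/2) a * t_moment \<beta> \<gamma> \<mu> (a + b))"
proof -
  define G where "G = (\<lambda>p. indicator cone2 p *\<^sub>R (monomial_xt a b p * jacobi_weight \<beta> \<gamma> \<mu> p))"
  define P where "P = (\<lambda>u. indicator {-1..1} u *\<^sub>R (u ^ a * ((u - -1) powr (\<mu> - 1/2) * (1 - u) powr (\<mu> - 1/2))))"
  define K where "K = (\<lambda>t. indicator {0..1} t *\<^sub>R (t ^ (a + b) * ((t - 0) powr (2 * \<mu> + \<beta>) * (1 - t) powr \<gamma>)))"
  have [measurable]: "G \<in> borel_measurable borel"
    unfolding G_def by measurable
  have sP: "set_integrable lborel {-1..1} (\<lambda>u. u ^ a * ((u - -1) powr (\<mu> - 1/2) * (1 - u) powr (\<mu> - 1/2)))"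
    using assms by (intro set_integrable_jacobi_density continuous_intros) auto
  then have P: "integrable lborel P" "integral\<^sup>L lborel P = gegenbauer_moment (\<mu> - 1/2) a"
    using set_borel_integral_eq_integral(2)[OF sP]
    by (simp_all add: P_def set_integrable_def set_lebesgue_integral_def gegenbauer_moment_def)
  have sK: "set_integrable lborel {0..1} (\<lambda>t. t ^ (a + b) * ((t - 0) powr (2 * \<mu> + \<beta>) * (1 - t) powr \<gamma>))"
    using assms by (intro set_integrable_jacobi_density continuous_intros) auto
  then have K: "integrable lborel K" "integral\<^sup>L lborel K = t_moment \<beta> \<gamma> \<mu> (a + b)"
    using set_borel_integral_eq_integral(2)[OF sK]
    by (simp_all add: K_def set_integrable_def set_lebesgue_integral_def t_moment_def)
  \<comment> \<open>The factor \<open>t\<close> on the left is the Jacobian of the substitution. The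
    shape \<open>0 + t * u\<close> is the one expected by the affine change of variable in
    \<open>lborel\<close>.\<close>
  have G_pos: "t * G (0 + t * u, t) = K t * P u" if "t > 0" for t u
  proof (cases "t \<le> 1 \<and> \<bar>u\<bar> \<le> 1")
    case True
    have "t\<^sup>2 - (t * u)\<^sup>2 = (t * t) * ((u - -1) * (1 - u))"
      by (simp add: algebra_simps power2_eq_square)
    also have "\<dots> powr (\<mu> - 1/2) = t powr (\<mu> - 1/2) * t powr (\<mu> - 1/2) * ((u - -1) powr (\<mu> - 1/2) * (1 - u) powr (\<mu> - 1/2))"
      using True that by (simp add: powr_mult)
    also have "t powr (\<mu> - 1/2) * t powr (\<mu> - 1/2) = t powr (2 * \<mu> - 1)"
      by (simp flip: powr_add)
    finally have e: "(t\<^sup>2 - (t * u)\<^sup>2) powr (\<mu> - 1/2) = t powr (2 * \<mu> - 1) * ((u - -1) powr (\<mu> - 1/2) * (1 - u) powr (\<mu> - 1/2))" .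
    have "t powr (2 * \<mu> + \<beta>) = t powr (1 + ((2 * \<mu> - 1) + \<beta>))"
      by (simp add: algebra_simps)
    also have "\<dots> = t * (t powr (2 * \<mu> - 1) * t powr \<beta>)"
      using that by (simp only: powr_add) simp
    finally have e2: "t powr (2 * \<mu> + \<beta>) = t * (t powr (2 * \<mu> - 1) * t powr \<beta>)" .
    have "u \<in> {-1..1}"
      using True by auto
    have "(t * u, t) \<in> cone2"
      using True that by (auto simp: cone2_def abs_mult)
    then have "t * G (0 + t * u, t) = t * ((t * u) ^ a * t ^ b * ((t\<^sup>2 - (t * u)\<^sup>2) powr (\<mu> - 1/2) * t powr \<beta> * (1 - t) powr \<gamma>))"
      by (simp add: G_def monomial_xt_def jacobi_weight_def)
    also have "\<dots> = K t * P u"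
      using True that \<open>u \<in> {-1..1}\<close> unfolding e by (simp add: K_def P_def e2[unfolded mult.commute[of 2 \<mu>]] power_mult_distrib power_add mult_ac)
    finally show ?thesis .
  next
    case False
    then have "(t * u, t) \<notin> cone2"
      using that by (auto simp: cone2_def abs_mult)
    then show ?thesis using False by (auto simp: G_def K_def P_def indicator_def)
  qed
  \<comment> \<open>The slice \<open>t = 0\<close> meets the cone only at the apex, where
    \<open>0 powr _ = 0\<close> makes the weight vanish, so the substitution never has to be made
    with \<open>t = 0\<close>.\<close>
  have G_neg: "G (x, t) = 0 \<and> K t = 0" if "t \<le> 0" for t x
    using that by (cases "t = 0") (auto simp: G_def K_def cone2_def indicator_def jacobi_weight_def)
  \<comment> \<open>The integral of the norm is recorded as well, because the Fubini criterion asks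
    for its integrability in \<open>t\<close>.\<close>
  have slice: "integrable lborel (\<lambda>x. G (x, t)) \<and> integral\<^sup>L lborel (\<lambda>x. G (x, t)) = K t * integral\<^sup>L lborel P
      \<and> integral\<^sup>L lborel (\<lambda>x. norm (G (x, t))) = \<bar>K t\<bar> * integral\<^sup>L lborel (\<lambda>u. \<bar>P u\<bar>)" for t
  proof (cases "t > 0")
    case True
    then have G': "G (0 + t * u, t) = K t / t * P u" for u
      using G_pos[of t u] by (simp add: field_simps)
    have "integrable lborel (\<lambda>u. G (0 + t * u, t))"
      unfolding G' using P by (intro integrable_mult_right)
    then have 1: "integrable lborel (\<lambda>x. G (x, t))"
      using True by (subst (asm) lborel_integrable_real_affine_iff[where f="\<lambda>x. G (x, t)"]) auto
    have 2: "integral\<^sup>L lborel (\<lambda>x. G (x, t)) = K t * integral\<^sup>L lborel P"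
      using True by (subst lborel_integral_real_affine[where c=t and t=0]) (simp_all only: G', simp_all)
    have 3: "integral\<^sup>L lborel (\<lambda>x. norm (G (x, t))) = \<bar>K t\<bar> * integral\<^sup>L lborel (\<lambda>u. \<bar>P u\<bar>)"
      using True by (subst lborel_integral_real_affine[where c=t and t=0]) (simp_all only: G', simp_all add: abs_mult)
    from 1 2 3 show ?thesis by blast
  next
    case False
    then show ?thesis using G_neg by simp
  qed
  have I: "integrable (lborel \<Otimes>\<^sub>M lborel) (\<lambda>(t, x). G (x, t))"
  proof (rule lborel_pair.Fubini_integrable)
    have "(\<lambda>p. G (snd p, fst p)) \<in> borel_measurable (lborel \<Otimes>\<^sub>M lborel)"
      by (rule measurable_compose[OF _ \<open>G \<in> _\<close>]) (simp add: borel_prod[symmetric])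
    then show "(\<lambda>(t, x). G (x, t)) \<in> borel_measurable (lborel \<Otimes>\<^sub>M lborel)"
      by (simp add: case_prod_beta')
    show "integrable lborel (\<lambda>t. \<integral>x. norm (case (t, x) of (t, x) \<Rightarrow> G (x, t)) \<partial>lborel)"
      using slice K(1) by simp
  qed (use slice in auto)
  have I': "integrable (lborel \<Otimes>\<^sub>M lborel) G"
    using lborel_pair.integrable_product_swap[OF I] by simp
  have "(\<integral>t. (\<integral>x. G (x, t) \<partial>lborel) \<partial>lborel) = integral\<^sup>L (lborel \<Otimes>\<^sub>M lborel) G"
    using lborel_pair.integral_snd[of "\<lambda>x t. G (x, t)"] I' by simp
  then have "integral\<^sup>L (lborel \<Otimes>\<^sub>M lborel) G = gegenbauer_moment (\<mu> - 1/2) a * t_moment \<beta> \<gamma> \<mu> (a + b)"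
    using slice by (simp add: P K mult.commute)
  with I' show ?thesis
    unfolding has_bochner_integral_iff G_def[symmetric] by (simp add: lborel_prod)
qed

subsection \<open>The inner product on polynomials of the plane\<close>

text \<open>Polynomials of arbitrary degree are the common domain of the bilinearity lemmas: a
  non-integrable function has Bochner integral 0 by default, so additivity has to be confined to
  functions known to be integrable against the weight.\<close>

definition plane_polys :: "(real \<times> real \<Rightarrow> real) set" where
  "plane_polys = fun_vs.span {monomial_xt i j | i j. True}"

lemma polys_le_subset: "polys_le n \<subseteq> plane_polys"
  unfolding polys_le_def plane_polys_def by (intro fun_vs.span_mono) auto

lemma polys_less_subset_le: "polys_less n \<subseteq> polys_le n"
  unfolding polys_le_def polys_less_def by (intro fun_vs.span_mono) (blast intro: less_imp_le)

lemma polys_less_subset: "polys_less n \<subseteq> plane_polys"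
  using polys_le_subset polys_less_subset_le by blast

lemma monomial_xt_plane: "monomial_xt i j \<in> plane_polys"
  unfolding plane_polys_def by (intro fun_vs.span_base) auto

lemma plane_polys_scale: "f \<in> plane_polys \<Longrightarrow> (\<lambda>p. c * f p) \<in> plane_polys"
  unfolding plane_polys_def by (rule fun_vs.span_scale)

lemma plane_polys_add: "f \<in> plane_polys \<Longrightarrow> g \<in> plane_polys \<Longrightarrow> f + g \<in> plane_polys"
  unfolding plane_polys_def by (rule fun_vs.span_add)

lemma plane_polys_diff: "f \<in> plane_polys \<Longrightarrow> g \<in> plane_polys \<Longrightarrow> f - g \<in> plane_polys"
  unfolding plane_polys_def by (rule fun_vs.span_diff)

lemma plane_polys_sum: "(\<And>i. i \<in> A \<Longrightarrow> f i \<in> plane_polys) \<Longrightarrow> sum f A \<in> plane_polys"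
  unfolding plane_polys_def by (rule fun_vs.span_sum)

lemma plane_polys_continuous: "f \<in> plane_polys \<Longrightarrow> continuous_on UNIV f"
  unfolding plane_polys_def
proof (induction rule: fun_vs.span_induct_alt)
  case base
  show ?case by (simp add: zero_fun_def)
next
  case (step c x y)
  then have "continuous_on UNIV x" using continuous_on_monomial_xt by auto
  with step show ?case by (auto simp: plus_fun_def intro!: continuous_intros)
qed

lemma plane_polys_line:
  assumes "f \<in> plane_polys"
  shows "\<exists>q. \<forall>s. f (a + s * b, c + s * d) = poly q s"
  using assms unfolding plane_polys_def
proof (induction rule: fun_vs.span_induct_alt)
  case base
  show ?case by (rule exI[of _ 0]) simp
next
  case (step e x y)
  then obtain q i j where q: "\<And>s. y (a + s * b, c + s * d) = poly q s" and x: "x = monomial_xt i j" by auto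
  show ?case
    by (rule exI[of _ "smult e ([:a, b:] ^ i * [:c, d:] ^ j) + q"]) (simp add: q x monomial_xt_def)
qed

text \<open>Identity theorem: restrict \<open>f\<close> to the line from \<open>p0\<close> to
  \<open>p\<close>. The resulting univariate polynomial vanishes for all small parameters, hence
  identically, and the parameter 1 is the point \<open>p\<close>.\<close>

lemma plane_polys_eq_0:
  assumes f: "f \<in> plane_polys" and S: "open S" "p0 \<in> S" and z: "\<And>p. p \<in> S \<Longrightarrow> f p = 0"
  shows "f = 0"
proof
  fix p :: "real \<times> real"
  obtain a c where p0: "p0 = (a, c)" by (cases p0)
  obtain x t where p: "p = (x, t)" by (cases p)
  obtain q where q: "\<And>s. f (a + s * (x - a), c + s * (t - c)) = poly q s"
    using plane_polys_line[OF f] by blast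
  have "open ((\<lambda>s. (a + s * (x - a), c + s * (t - c))) -` S)"
    using S(1) by (intro open_vimage continuous_intros)
  moreover have "0 \<in> (\<lambda>s. (a + s * (x - a), c + s * (t - c))) -` S"
    using S(2) p0 by simp
  ultimately obtain e where e: "e > 0" "ball 0 e \<subseteq> (\<lambda>s. (a + s * (x - a), c + s * (t - c))) -` S"
    using open_contains_ball by blast
  have "ball 0 e \<subseteq> {s. poly q s = 0}"
    using e(2) z q by fastforce
  moreover have "infinite (ball (0::real) e)"
    using e(1) by (simp add: ball_eq_greaterThanLessThan)
  ultimately have "q = 0"
    using poly_roots_finite finite_subset by blast
  then show "f p = 0 p"
    using q[of 1] p by simp
qed

lemma interior_cone2: "interior cone2 = {(x, t). \<bar>x\<bar> < t \<and> t < 1}"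
proof (rule interior_unique)
  have "{(x::real, t). \<bar>x\<bar> < t \<and> t < 1} = {p. \<bar>fst p\<bar> < snd p} \<inter> {p. snd p < 1}"
    by auto
  also have "open \<dots>"
    by (intro open_Int open_Collect_less continuous_intros)
  finally show "open {(x::real, t). \<bar>x\<bar> < t \<and> t < 1}" .
  show "{(x::real, t). \<bar>x\<bar> < t \<and> t < 1} \<subseteq> cone2"
    by (auto simp: cone2_def)
  fix T assume T: "T \<subseteq> cone2" "open T"
  show "T \<subseteq> {(x, t). \<bar>x\<bar> < t \<and> t < 1}"
  proof clarify
    fix x t assume xt: "(x, t) \<in> T"
    obtain e where e: "e > 0" "ball (x, t) e \<subseteq> T"
      using T(2) xt open_contains_ball by blast
    \<comment> \<open>Moving up by \<open>e/2\<close> stays below height 1 and moving down by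
      \<open>e/2\<close> keeps \<bar>x\<bar> below the height; this makes both inequalities
      strict.\<close>
    have "dist (x, t) (x, t + e/2) < e" "dist (x, t) (x, t - e/2) < e"
      using e(1) by (simp_all add: dist_Pair_Pair dist_real_def)
    then have "(x, t + e/2) \<in> cone2" "(x, t - e/2) \<in> cone2"
      using e(2) T(1) by auto
    then show "\<bar>x\<bar> < t \<and> t < 1"
      using e(1) by (auto simp: cone2_def)
  qed
qed

lemma interior_cone2_nonempty: "(0, 1/2) \<in> interior cone2"
  by (simp add: interior_cone2)

section \<open>Bilinearity and definiteness of the inner product\<close>

locale cone_jacobi =
  fixes \<beta> \<gamma> \<mu> :: real
  assumes \<mu>: "\<mu> > -1/2" and \<gamma>: "\<gamma> > -1" and \<beta>\<mu>: "2 * \<mu> + \<beta> + 1 > 0"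
begin

abbreviation "ip \<equiv> jacobi_ip \<beta> \<gamma> \<mu>"

text \<open>A product of two monomials is a monomial, so span induction in each argument reduces the
  claim to the cone moments.\<close>

lemma integrable_ip:
  assumes "f \<in> plane_polys" "g \<in> plane_polys"
  shows "set_integrable lborel cone2 (\<lambda>p. f p * g p * jacobi_weight \<beta> \<gamma> \<mu> p)"
  using assms(1) unfolding plane_polys_def
proof (induction rule: fun_vs.span_induct_alt)
  case base
  show ?case by (simp add: set_integrable_def)
next
  case (step c x y)
  then obtain i j where x: "x = monomial_xt i j" by auto
  have "set_integrable lborel cone2 (\<lambda>p. x p * g p * jacobi_weight \<beta> \<gamma> \<mu> p)"
    using assms(2) unfolding plane_polys_def
  proof (induction rule: fun_vs.span_induct_alt)
    case base
    show ?case by (simp add: set_integrable_def)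
  next
    case (step c' x' y')
    then obtain i' j' where x': "x' = monomial_xt i' j'" by auto
    have "x p * x' p = monomial_xt (i + i') (j + j') p" for p
      by (cases p) (simp add: x x' monomial_xt_def power_add)
    then have "set_integrable lborel cone2 (\<lambda>p. x p * x' p * jacobi_weight \<beta> \<gamma> \<mu> p)"
      using has_bochner_integral_cone_moment[OF \<mu> \<gamma> \<beta>\<mu>]
      by (auto simp: set_integrable_def has_bochner_integral_iff)
    then have "set_integrable lborel cone2
        (\<lambda>p. c' * (x p * x' p * jacobi_weight \<beta> \<gamma> \<mu> p) + x p * y' p * jacobi_weight \<beta> \<gamma> \<mu> p)"
      using step by (intro set_integral_add set_integrable_mult_right)
    then show ?case by (simp add: algebra_simps)
  qed
  then have "set_integrable lborel cone2
      (\<lambda>p. c * (x p * g p * jacobi_weight \<beta> \<gamma> \<mu> p) + y p * g p * jacobi_weight \<beta> \<gamma> \<mu> p)"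
    using step by (intro set_integral_add set_integrable_mult_right)
  then show ?case by (simp add: algebra_simps)
qed

lemma ip_commute: "ip f g = ip g f"
  by (simp add: jacobi_ip_def mult.commute)

lemma ip_add:
  assumes "f \<in> plane_polys" "g \<in> plane_polys" "h \<in> plane_polys"
  shows "ip (f + g) h = ip f h + ip g h"
  using set_integral_add(2)[OF integrable_ip[OF assms(1,3)] integrable_ip[OF assms(2,3)]]
  by (simp add: jacobi_ip_def algebra_simps)

lemma ip_scale: "ip (\<lambda>p. c * f p) g = c * ip f g"
  by (simp add: jacobi_ip_def mult.assoc)

lemma ip_zero: "ip 0 g = 0"
  by (simp add: jacobi_ip_def)

lemma ip_diff:
  assumes "f \<in> plane_polys" "g \<in> plane_polys" "h \<in> plane_polys"
  shows "ip (f - g) h = ip f h - ip g h"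
  using ip_add[OF plane_polys_diff[OF assms(1,2)] assms(2,3)] by (simp add: fun_eq_iff)

lemma ip_sum:
  assumes "\<And>i. i \<in> A \<Longrightarrow> f i \<in> plane_polys" "h \<in> plane_polys"
  shows "ip (sum f A) h = (\<Sum>i\<in>A. ip (f i) h)"
  using assms
proof (induction A rule: infinite_finite_induct)
  case (insert x F)
  then have "ip (f x + sum f F) h = ip (f x) h + ip (sum f F) h"
    by (intro ip_add plane_polys_sum) auto
  also have "ip (sum f F) h = (\<Sum>i\<in>F. ip (f i) h)"
    using insert by blast
  finally show ?case by (subst (1 2) sum.insert[OF insert.hyps])
qed (simp_all add: ip_zero)

text \<open>A nonnegative integrand with integral 0 vanishes almost everywhere, and the weight is
  positive in the interior. The interior points with \<open>f p \<noteq> 0\<close> then form an open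
  null set, which is empty, and the identity theorem applies.\<close>

lemma ip_definite:
  assumes f: "f \<in> plane_polys" and 0: "ip f f = 0"
  shows "f = 0"
proof (rule plane_polys_eq_0[OF f])
  let ?h = "\<lambda>p. indicator cone2 p *\<^sub>R (f p * f p * jacobi_weight \<beta> \<gamma> \<mu> p)"
  have w: "jacobi_weight \<beta> \<gamma> \<mu> p \<ge> 0" for p
    by (cases p) (simp add: jacobi_weight_def)
  have "integrable lborel ?h"
    using integrable_ip[OF f f] by (simp add: set_integrable_def)
  then have "AE p in lborel. ?h p = 0"
    using 0 w by (subst integral_nonneg_eq_0_iff_AE[symmetric])
      (auto simp: jacobi_ip_def set_lebesgue_integral_def)
  then have ae: "AE p in lborel. p \<in> interior cone2 \<longrightarrow> f p = 0"
  proof eventually_elim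
    case (elim p)
    show ?case
    proof
      assume p: "p \<in> interior cone2"
      then have "jacobi_weight \<beta> \<gamma> \<mu> p > 0"
      proof -
        obtain x t where xt: "p = (x, t)" by (cases p)
        then have "\<bar>x\<bar> < t" "t < 1" using p by (auto simp: interior_cone2)
        moreover from this have "x\<^sup>2 < t\<^sup>2" using power_strict_mono[of "\<bar>x\<bar>" t 2] by simp
        ultimately show ?thesis by (simp add: jacobi_weight_def xt)
      qed
      with elim p show "f p = 0"
        using interior_subset by (auto simp: indicator_def split: if_splits)
    qed
  qed
  let ?N = "{p \<in> interior cone2. f p \<noteq> 0}"
  have op: "open ?N"
  proof -
    have "?N = interior cone2 \<inter> (f -` (- {0}))" by auto
    then show ?thesis
      using plane_polys_continuous[OF f] by (auto intro!: open_Int open_vimage)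
  qed
  have "AE p in lborel. p \<notin> ?N"
    using ae by eventually_elim auto
  then have "?N \<in> null_sets lborel"
    using op by (subst (asm) AE_iff_null_sets[symmetric]) auto
  then have "?N = {}"
    using open_not_negligible[OF op] by (auto simp: negligible_iff_null_sets null_sets_completionI)
  then show "\<And>p. p \<in> interior cone2 \<Longrightarrow> f p = 0" by blast
qed (use interior_cone2_nonempty in auto)

end

subsection \<open>Moments of the Gegenbauer weight\<close>

lemma has_integral_gegenbauer_moment:
  assumes "c > -1"
  shows "((\<lambda>u. u ^ e * ((u - -1) powr c * (1 - u) powr c)) has_integral gegenbauer_moment c e) {-1..1}"
  unfolding gegenbauer_moment_def using assms
  by (intro integrable_integral jacobi_density_integrable_on continuous_intros) auto

text \<open>The reflection of \<open>u\<close> to \<open>-u\<close> changes the sign of the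
  integrand.\<close>

lemma gegenbauer_moment_odd:
  assumes "c > -1" "odd e"
  shows "gegenbauer_moment c e = 0"
proof -
  let ?f = "\<lambda>u. u ^ e * ((u - -1) powr c * (1 - u) powr c)"
  have "integral {-1..1} (\<lambda>u. ?f (- u)) = integral {-1..1} ?f"
    using Henstock_Kurzweil_Integration.integral_reflect_real[of 1 "-1" ?f] by simp
  moreover have "integral {-1..1} (\<lambda>u. ?f (- u)) = integral {-1..1} (\<lambda>u. - ?f u)"
    using assms(2) by (intro arg_cong[where f="integral {-1..1}"]) (auto simp: fun_eq_iff algebra_simps)
  moreover have "integral {-1..1} (\<lambda>u. - ?f u) = - integral {-1..1} ?f"
    by (rule integral_neg)
  ultimately have "integral {-1..1} ?f = 0"
    by linarith
  then show ?thesis by (simp add: gegenbauer_moment_def)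
qed

lemma gegenbauer_moment_raise:
  assumes "c > -1"
  shows "gegenbauer_moment (c + 1) e = gegenbauer_moment c e - gegenbauer_moment c (e + 2)"
proof -
  have "((\<lambda>u. u ^ e * ((u - -1) powr (c + 1) * (1 - u) powr (c + 1)))
      has_integral gegenbauer_moment c e - gegenbauer_moment c (e + 2)) {-1..1}"
  proof (rule has_integral_eq[OF _ has_integral_diff[OF has_integral_gegenbauer_moment has_integral_gegenbauer_moment]])
    fix u :: real assume "u \<in> {-1..1}"
    then have "(u - -1) powr (c + 1) = (u - -1) powr c * (u - -1)" "(1 - u) powr (c + 1) = (1 - u) powr c * (1 - u)"
      by (simp_all add: powr_add)
    then show "u ^ e * ((u - -1) powr c * (1 - u) powr c) - u ^ (e + 2) * ((u - -1) powr c * (1 - u) powr c)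
      = u ^ e * ((u - -1) powr (c + 1) * (1 - u) powr (c + 1))"
      by (simp only:) (simp add: algebra_simps)
  qed (use assms in auto)
  then show ?thesis unfolding gegenbauer_moment_def by (rule integral_unique)
qed

text \<open>Integration by parts of \<open>u^(e+1)\<close> against the derivative
  \<open>-2 (c + 1) u (1 - u^2)^c\<close> of \<open>(1 - u^2)^(c+1)\<close>.\<close>

lemma gegenbauer_moment_step:
  assumes "c > -1"
  shows "2 * (c + 1) * gegenbauer_moment c (e + 2) = (real e + 1) * gegenbauer_moment (c + 1) e"
proof -
  have "((\<lambda>u. (real e + 1) * (u ^ e * ((u - -1) powr (c + 1) * (1 - u) powr (c + 1))))
      has_integral (real e + 1) * gegenbauer_moment (c + 1) e) {-1..1}"
    using assms by (intro has_integral_mult_right has_integral_gegenbauer_moment) auto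
  then have "((\<lambda>u. poly ((pderiv ^^ 1) (monom 1 (e + 1))) u * ((u - -1) powr (c + 1) * (1 - u) powr (c + 1)))
      has_integral (real e + 1) * gegenbauer_moment (c + 1) e) {-1..1}"
    by (simp add: pderiv_monom poly_monom mult.assoc add.commute[of 1 "real e"])
  from rodrigues_parts[OF _ _ _ this] assms
  have "((\<lambda>u. - (2 * (c + 1)) * (u ^ (e + 2) * ((u - -1) powr c * (1 - u) powr c)))
      has_integral (- ((real e + 1) * gegenbauer_moment (c + 1) e))) {-1..1}"
    by (simp add: poly_monom algebra_simps)
  moreover have "((\<lambda>u. - (2 * (c + 1)) * (u ^ (e + 2) * ((u - -1) powr c * (1 - u) powr c)))
      has_integral (- (2 * (c + 1)) * gegenbauer_moment c (e + 2))) {-1..1}"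
    using assms by (intro has_integral_mult_right has_integral_gegenbauer_moment) auto
  ultimately have "- ((real e + 1) * gegenbauer_moment (c + 1) e) = - (2 * (c + 1)) * gegenbauer_moment c (e + 2)"
    by (rule has_integral_unique)
  then show ?thesis by (simp only: mult_minus_left neg_equal_iff_equal)
qed

text \<open>Eliminating the moment of parameter \<open>c + 1\<close> between the two preceding
  relations leaves a two-term recurrence from \<open>e\<close> to \<open>e + 2\<close>, which is
  solved by Pochhammer symbols.\<close>

lemma gegenbauer_moment_even:
  assumes "c > -1"
  shows "gegenbauer_moment c (2 * i) = pochhammer (1/2) i / pochhammer (c + 3/2) i * gegenbauer_moment c 0"
proof (induction i)
  case (Suc i)
  have "(2 * c + 2 * real i + 3) * gegenbauer_moment c (2 * i + 2) = (2 * real i + 1) * gegenbauer_moment c (2 * i)"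
    using gegenbauer_moment_step[OF assms, of "2 * i", unfolded gegenbauer_moment_raise[OF assms]]
    by (simp add: algebra_simps)
  then have "gegenbauer_moment c (2 * Suc i) = (1/2 + real i) / (c + 3/2 + real i) * gegenbauer_moment c (2 * i)"
    using assms by (simp add: field_simps)
  then show ?case using Suc by (simp add: pochhammer_Suc mult_ac)
qed simp

text \<open>Raising the parameter by 1 subtracts the second moment, which is the fraction
  \<open>1 / (2 c + 3)\<close> of the zeroth one; this is iterated with \<open>c + i\<close> for
  \<open>c\<close>.\<close>

lemma gegenbauer_moment_shift:
  assumes "c > -1"
  shows "gegenbauer_moment (c + real i) 0 = pochhammer (c + 1) i / pochhammer (c + 3/2) i * gegenbauer_moment c 0"
proof (induction i)
  case (Suc i)
  have c: "c + real i > -1" using assms by linarith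
  have "gegenbauer_moment (c + real i) 2 = 1 / (2 * (c + real i) + 3) * gegenbauer_moment (c + real i) 0"
    using gegenbauer_moment_even[OF c, of 1] by (simp add: field_simps numeral_2_eq_2)
  with gegenbauer_moment_raise[OF c, of 0, unfolded add_0_left]
  have "gegenbauer_moment (c + real i + 1) 0 = (1 - 1 / (2 * (c + real i) + 3)) * gegenbauer_moment (c + real i) 0"
    by (simp add: left_diff_distrib)
  also have "1 - 1 / (2 * (c + real i) + 3) = (c + 1 + real i) / (c + 3/2 + real i)"
    using c by (simp add: field_simps)
  finally show ?case using Suc by (simp add: pochhammer_Suc add_ac mult_ac)
qed simp

text \<open>The map of \<open>u\<close> to \<open>u/2 + 1/2\<close> identifies the moment, up to a
  positive factor, with \<open>Beta (c + 1) (c + 1)\<close>.\<close>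

lemma gegenbauer_moment_pos:
  assumes "c > -1"
  shows "gegenbauer_moment c 0 > 0"
proof -
  have "((\<lambda>t. t powr c * (1 - t) powr c) has_integral Beta (c + 1) (c + 1)) (cbox 0 1)"
    using has_integral_Beta_real[of "c + 1" "c + 1"] assms by simp
  from has_integral_affinity'[OF this, of "1/2" "1/2"]
  have "((\<lambda>u. (u / 2 + 1 / 2) powr c * (1 - (u / 2 + 1 / 2)) powr c) has_integral 2 * Beta (c + 1) (c + 1)) {-1..1}"
    by simp
  then have "((\<lambda>u. (1/2) powr c * (1/2) powr c * (u ^ 0 * ((u - -1) powr c * (1 - u) powr c))) has_integral 2 * Beta (c + 1) (c + 1)) {-1..1}"
  proof (rule has_integral_eq[rotated])
    fix u :: real assume "u \<in> {-1..1}"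
    moreover have "u / 2 + 1 / 2 = (u - -1) * (1/2)" "1 - (u / 2 + 1 / 2) = (1 - u) * (1/2)"
      by (simp_all add: field_simps)
    ultimately show "(u / 2 + 1 / 2) powr c * (1 - (u / 2 + 1 / 2)) powr c = (1/2) powr c * (1/2) powr c * (u ^ 0 * ((u - -1) powr c * (1 - u) powr c))"
      by (simp only: powr_mult) simp
  qed
  moreover have "((\<lambda>u. (1/2) powr c * (1/2) powr c * (u ^ 0 * ((u - -1) powr c * (1 - u) powr c))) has_integral
     (1/2) powr c * (1/2) powr c * gegenbauer_moment c 0) {-1..1}"
    using assms by (intro has_integral_mult_right has_integral_gegenbauer_moment)
  ultimately have "(1/2) powr c * (1/2) powr c * gegenbauer_moment c 0 = 2 * Beta (c + 1) (c + 1)"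
    by (rule has_integral_unique[rotated])
  moreover have "Beta (c + 1) (c + 1) > 0"
    using assms by (simp add: Beta_def Gamma_real_pos)
  ultimately show ?thesis by (metis mult_pos_pos powr_gt_zero zero_less_mult_pos zero_less_numeral zero_less_divide_1_iff less_numeral_extra(3))
qed

subsection \<open>Moments of the Rodrigues polynomials\<close>

lemma poly_sum_atMost:
  fixes p :: "'a :: comm_semiring_1 poly"
  assumes "degree p \<le> n"
  shows "poly p x = (\<Sum>i\<le>n. coeff p i * x ^ i)"
  unfolding poly_altdef using assms
  by (intro sum.mono_neutral_left) (auto simp: coeff_eq_0)

text \<open>Up to a constant, the Gegenbauer polynomial of degree \<open>k\<close> for the weight
  \<open>(1 - u^2)^(\<mu> - 1/2)\<close>.\<close>

definition x_factor :: "real \<Rightarrow> nat \<Rightarrow> real poly" where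
  "x_factor \<mu> k = rodrigues_poly (-1) 1 (real k + \<mu> - 1/2) (real k + \<mu> - 1/2) k"

text \<open>For \<open>k \<le> n\<close>, up to a constant the Jacobi polynomial of degree
  \<open>n - k\<close> on \<open>[0, 1]\<close> for the weight
  \<open>t^(2k + 2 \<mu> + \<beta>) (1 - t)^\<gamma>\<close>.\<close>

definition t_factor :: "real \<Rightarrow> real \<Rightarrow> real \<Rightarrow> nat \<Rightarrow> nat \<Rightarrow> real poly" where
  "t_factor \<beta> \<gamma> \<mu> k n = rodrigues_poly 0 1 (real n + real k + \<beta> + 2 * \<mu>) (\<gamma> + real n - real k) (n - k)"

text \<open>This is \<open>t\<^sup>k X(x/t) T(t)\<close> for the two factors \<open>X\<close>, \<open>T\<close>, expanded so that no junk value
  of \<open>x/t\<close> enters at \<open>t = 0\<close>.\<close>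

definition product_U :: "real \<Rightarrow> real \<Rightarrow> real \<Rightarrow> nat \<Rightarrow> nat \<Rightarrow> real \<times> real \<Rightarrow> real" where
  "product_U \<beta> \<gamma> \<mu> k n = (\<Sum>(c, e)\<in>{..k} \<times> {..n - k}.
     (\<lambda>p. coeff (x_factor \<mu> k) c * coeff (t_factor \<beta> \<gamma> \<mu> k n) e * monomial_xt c (k - c + e) p))"

lemma degree_x_factor: "degree (x_factor \<mu> k) \<le> k"
  by (simp add: x_factor_def degree_rodrigues_poly)

lemma degree_t_factor: "degree (t_factor \<beta> \<gamma> \<mu> k n) \<le> n - k"
  by (simp add: t_factor_def degree_rodrigues_poly)

lemma sum_fun_apply: "(\<Sum>i\<in>A. f i) p = (\<Sum>i\<in>A. f i p)"
  by (induction A rule: infinite_finite_induct) simp_all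

lemma product_U_polys_le:
  assumes "k \<le> n"
  shows "product_U \<beta> \<gamma> \<mu> k n \<in> polys_le n"
  unfolding product_U_def polys_le_def
proof (intro fun_vs.span_sum)
  fix q assume "q \<in> {..k} \<times> {..n - k}"
  then obtain c e where q: "q = (c, e)" "c \<le> k" "e \<le> n - k" by auto
  then have "c + (k - c + e) \<le> n" using assms by simp
  then have "monomial_xt c (k - c + e) \<in> {monomial_xt i j | i j. i + j \<le> n}" by blast
  then show "(case q of (c, e) \<Rightarrow> (\<lambda>p. coeff (x_factor \<mu> k) c * coeff (t_factor \<beta> \<gamma> \<mu> k n) e * monomial_xt c (k - c + e) p))
    \<in> fun_vs.span {monomial_xt i j | i j. i + j \<le> n}"
    unfolding q prod.case by (intro fun_vs.span_scale fun_vs.span_base)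
qed

lemma product_U_apply:
  assumes "t \<noteq> 0"
  shows "product_U \<beta> \<gamma> \<mu> k n (x, t) = t ^ k * poly (x_factor \<mu> k) (x / t) * poly (t_factor \<beta> \<gamma> \<mu> k n) t"
proof -
  have "t ^ k * poly (x_factor \<mu> k) (x / t) * poly (t_factor \<beta> \<gamma> \<mu> k n) t
    = (\<Sum>c\<le>k. \<Sum>e\<le>n - k. t ^ k * (coeff (x_factor \<mu> k) c * (x / t) ^ c) * (coeff (t_factor \<beta> \<gamma> \<mu> k n) e * t ^ e))"
    unfolding poly_sum_atMost[OF degree_x_factor] poly_sum_atMost[OF degree_t_factor]
    by (simp add: sum_distrib_left sum_distrib_right) (rule sum.swap)
  also have "\<dots> = (\<Sum>c\<le>k. \<Sum>e\<le>n - k. coeff (x_factor \<mu> k) c * coeff (t_factor \<beta> \<gamma> \<mu> k n) e * monomial_xt c (k - c + e) (x, t))"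
    using assms by (intro sum.cong refl) (auto simp: monomial_xt_def power_divide power_add power_diff)
  finally show ?thesis
    by (simp only: product_U_def sum_fun_apply sum.cartesian_product case_prod_beta')
qed

text \<open>Writing \<open>t^2 - y^2\<close> as \<open>(y + t) (t - y)\<close> makes both
  derivatives univariate Rodrigues derivatives, the first on \<open>(-t, t)\<close>, which is
  rescaled to \<open>(-1, 1)\<close>. The powers they leave cancel the prefactors of the
  formula.\<close>

lemma rodrigues_U_eq_product_U:
  assumes "k \<le> n" "p \<in> interior cone2"
  shows "rodrigues_U \<beta> \<gamma> \<mu> k n p = product_U \<beta> \<gamma> \<mu> k n p"
proof -
  obtain x t where p: "p = (x, t)" by (cases p)
  have xt: "\<bar>x\<bar> < t" "t < 1" using assms(2) by (auto simp: p interior_cone2)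
  then have t: "t > 0" "t * -1 < x" "x < t * 1" by auto
  have sq: "t\<^sup>2 - y\<^sup>2 = (y - t * -1) * (t * 1 - y)" for y
    by (simp add: power2_eq_square algebra_simps)
  have pos: "t\<^sup>2 - x\<^sup>2 > 0" unfolding sq using t by auto
  have "(deriv ^^ k) (\<lambda>y. (t\<^sup>2 - y\<^sup>2) powr (real k + \<mu> - 1/2)) x
    = (x - t * -1) powr (real k + \<mu> - 1/2 - real k) * (t * 1 - x) powr (real k + \<mu> - 1/2 - real k)
      * poly (rodrigues_poly (t * -1) (t * 1) (real k + \<mu> - 1/2) (real k + \<mu> - 1/2) k) x"
    using t by (intro higher_deriv_rodrigues) (auto simp only: sq intro!: powr_mult)
  also have "\<dots> = (t\<^sup>2 - x\<^sup>2) powr (\<mu> - 1/2) * (t ^ k * poly (x_factor \<mu> k) (x / t))"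
  proof -
    have "t \<noteq> 0" using t by simp
    have "poly (rodrigues_poly (t * -1) (t * 1) (real k + \<mu> - 1/2) (real k + \<mu> - 1/2) k) x
        = t ^ k * poly (x_factor \<mu> k) (x / t)"
      unfolding rodrigues_poly_scale[OF \<open>t \<noteq> 0\<close>] x_factor_def by (simp add: poly_pcompose)
    moreover have "(t\<^sup>2 - x\<^sup>2) powr (\<mu> - 1/2) = (x - t * -1) powr (\<mu> - 1/2) * (t * 1 - x) powr (\<mu> - 1/2)"
      unfolding sq by (rule powr_mult)
    ultimately show ?thesis by simp
  qed
  finally have dx: "(deriv ^^ k) (\<lambda>y. (t\<^sup>2 - y\<^sup>2) powr (real k + \<mu> - 1/2)) x
    = (t\<^sup>2 - x\<^sup>2) powr (\<mu> - 1/2) * (t ^ k * poly (x_factor \<mu> k) (x / t))" .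
  have e: "real n + real k + \<beta> + 2 * \<mu> - real (n - k) = (2 * real k + 2 * \<mu>) + \<beta>" "\<gamma> + real n - real k - real (n - k) = \<gamma>"
    using assms(1) by (simp_all add: of_nat_diff)
  have "(deriv ^^ (n - k)) (\<lambda>s. s powr (real n + real k + \<beta> + 2 * \<mu>) * (1 - s) powr (\<gamma> + real n - real k)) t
    = (t - 0) powr (real n + real k + \<beta> + 2 * \<mu> - real (n - k)) * (1 - t) powr (\<gamma> + real n - real k - real (n - k))
      * poly (t_factor \<beta> \<gamma> \<mu> k n) t"
    unfolding t_factor_def using t xt by (intro higher_deriv_rodrigues) auto
  also have "\<dots> = t powr (2 * real k + 2 * \<mu>) * t powr \<beta> * (1 - t) powr \<gamma> * poly (t_factor \<beta> \<gamma> \<mu> k n) t"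
    unfolding e by (simp add: powr_add)
  finally have dt: "(deriv ^^ (n - k)) (\<lambda>s. s powr (real n + real k + \<beta> + 2 * \<mu>) * (1 - s) powr (\<gamma> + real n - real k)) t
    = t powr (2 * real k + 2 * \<mu>) * t powr \<beta> * (1 - t) powr \<gamma> * poly (t_factor \<beta> \<gamma> \<mu> k n) t" .
  have nz: "t powr (2 * real k + 2 * \<mu>) \<noteq> 0" "t powr \<beta> \<noteq> 0" "(1 - t) powr \<gamma> \<noteq> 0" "(t\<^sup>2 - x\<^sup>2) powr (\<mu> - 1/2) \<noteq> 0"
    using t xt pos by auto
  have "t \<noteq> 0" using t by simp
  show ?thesis
    unfolding p rodrigues_U_def prod.case dx dt product_U_apply[OF \<open>t \<noteq> 0\<close>] jacobi_weight_def
    using nz by (simp add: divide_simps)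
qed

text \<open>The definite description is well defined: two polynomials that agree in the interior of
  the cone are equal by the identity theorem.\<close>

lemma U_poly_eq_product_U:
  assumes "k \<le> n"
  shows "U_poly \<beta> \<gamma> \<mu> k n = product_U \<beta> \<gamma> \<mu> k n"
  unfolding U_poly_def
proof (rule the_equality)
  show "(\<exists>m. product_U \<beta> \<gamma> \<mu> k n \<in> polys_le m)
      \<and> (\<forall>p\<in>interior cone2. product_U \<beta> \<gamma> \<mu> k n p = rodrigues_U \<beta> \<gamma> \<mu> k n p)"
    using product_U_polys_le rodrigues_U_eq_product_U assms by metis
next
  fix f assume f: "(\<exists>m. f \<in> polys_le m) \<and> (\<forall>p\<in>interior cone2. f p = rodrigues_U \<beta> \<gamma> \<mu> k n p)"
  have "f - product_U \<beta> \<gamma> \<mu> k n \<in> plane_polys"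
    using f product_U_polys_le[OF assms] polys_le_subset
    unfolding plane_polys_def by (intro fun_vs.span_diff) blast+
  then have "f - product_U \<beta> \<gamma> \<mu> k n = 0"
    by (rule plane_polys_eq_0[OF _ open_interior interior_cone2_nonempty])
      (use f rodrigues_U_eq_product_U assms in auto)
  then show "f = product_U \<beta> \<gamma> \<mu> k n" by (simp only: right_minus_eq)
qed

section \<open>Moments of \<open>U_poly\<close> against monomials\<close>

context cone_jacobi
begin

lemma ip_monomials: "ip (monomial_xt i j) (monomial_xt a b) = gegenbauer_moment (\<mu> - 1/2) (a + i) * t_moment \<beta> \<gamma> \<mu> (a + b + i + j)"
proof -
  have "monomial_xt i j p * monomial_xt a b p = monomial_xt (a + i) (b + j) p" for p
    by (cases p) (simp add: monomial_xt_def power_add)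
  then show ?thesis
    using has_bochner_integral_integral_eq[OF has_bochner_integral_cone_moment[OF \<mu> \<gamma> \<beta>\<mu>, of "a + i" "b + j"]]
    by (simp add: jacobi_ip_def set_lebesgue_integral_def add_ac)
qed

text \<open>The term with indices \<open>c\<close>, \<open>e\<close> has total degree
  \<open>k + e\<close> regardless of \<open>c\<close>, so its moment splits into a factor in
  \<open>c\<close> and a factor in \<open>e\<close>.\<close>

lemma ip_product_U_monomial:
  "ip (product_U \<beta> \<gamma> \<mu> k n) (monomial_xt a b) =
    (\<Sum>c\<le>k. coeff (x_factor \<mu> k) c * gegenbauer_moment (\<mu> - 1/2) (a + c))
    * (\<Sum>e\<le>n - k. coeff (t_factor \<beta> \<gamma> \<mu> k n) e * t_moment \<beta> \<gamma> \<mu> (k + a + b + e))"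
proof -
  have "ip (product_U \<beta> \<gamma> \<mu> k n) (monomial_xt a b) = (\<Sum>q\<in>{..k} \<times> {..n - k}.
     ip (\<lambda>p. coeff (x_factor \<mu> k) (fst q) * coeff (t_factor \<beta> \<gamma> \<mu> k n) (snd q) * monomial_xt (fst q) (k - fst q + snd q) p) (monomial_xt a b))"
    unfolding product_U_def case_prod_beta'
    by (intro ip_sum plane_polys_scale monomial_xt_plane)
  also have "\<dots> = (\<Sum>q\<in>{..k} \<times> {..n - k}.
     coeff (x_factor \<mu> k) (fst q) * coeff (t_factor \<beta> \<gamma> \<mu> k n) (snd q) *
       (gegenbauer_moment (\<mu> - 1/2) (a + fst q) * t_moment \<beta> \<gamma> \<mu> (k + a + b + snd q)))"
    unfolding ip_scale ip_monomials by (intro sum.cong refl) (auto simp: add_ac)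
  also have "\<dots> = (\<Sum>c\<le>k. \<Sum>e\<le>n - k.
     coeff (x_factor \<mu> k) c * coeff (t_factor \<beta> \<gamma> \<mu> k n) e *
       (gegenbauer_moment (\<mu> - 1/2) (a + c) * t_moment \<beta> \<gamma> \<mu> (k + a + b + e)))"
    unfolding sum.cartesian_product by (simp add: case_prod_beta')
  also have "\<dots> = (\<Sum>c\<le>k. coeff (x_factor \<mu> k) c * gegenbauer_moment (\<mu> - 1/2) (a + c))
    * (\<Sum>e\<le>n - k. coeff (t_factor \<beta> \<gamma> \<mu> k n) e * t_moment \<beta> \<gamma> \<mu> (k + a + b + e))"
    unfolding sum_product by (simp add: mult_ac)
  finally show ?thesis .
qed

text \<open>All \<open>k\<close> derivatives are moved onto \<open>u^a\<close>; they annihilate it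
  when \<open>a < k\<close>.\<close>

lemma x_factor_moment:
  "(\<Sum>c\<le>k. coeff (x_factor \<mu> k) c * gegenbauer_moment (\<mu> - 1/2) (a + c)) =
    (if k \<le> a then (-1) ^ k * (fact a / fact (a - k)) * gegenbauer_moment (real k + \<mu> - 1/2) (a - k) else 0)"
proof -
  let ?w = "\<lambda>c u. (u - -1) powr c * (1 - u) powr c"
  have "((\<lambda>u. \<Sum>c\<le>k. coeff (x_factor \<mu> k) c * (u ^ (a + c) * ?w (\<mu> - 1/2) u))
    has_integral (\<Sum>c\<le>k. coeff (x_factor \<mu> k) c * gegenbauer_moment (\<mu> - 1/2) (a + c))) {-1..1}"
    using \<mu> by (intro has_integral_sum has_integral_mult_right has_integral_gegenbauer_moment) auto
  also have "(\<lambda>u. \<Sum>c\<le>k. coeff (x_factor \<mu> k) c * (u ^ (a + c) * ?w (\<mu> - 1/2) u))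
    = (\<lambda>u. u ^ a * (?w (\<mu> - 1/2) u * poly (x_factor \<mu> k) u))"
    unfolding poly_sum_atMost[OF degree_x_factor] sum_distrib_left
    by (intro ext sum.cong refl) (simp add: power_add)
  finally have L: "((\<lambda>u. u ^ a * (?w (\<mu> - 1/2) u * poly (x_factor \<mu> k) u))
    has_integral (\<Sum>c\<le>k. coeff (x_factor \<mu> k) c * gegenbauer_moment (\<mu> - 1/2) (a + c))) {-1..1}" .
  define I where "I = (if k \<le> a then (fact a / fact (a - k)) * gegenbauer_moment (real k + \<mu> - 1/2) (a - k) else 0)"
  have "((\<lambda>u. poly ((pderiv ^^ k) (monom 1 a)) u * ?w (real k + \<mu> - 1/2) u) has_integral I) {-1..1}"
  proof (cases "k \<le> a")
    case True
    have "((\<lambda>u. fact a / fact (a - k) * (u ^ (a - k) * ?w (real k + \<mu> - 1/2) u)) has_integral I) {-1..1}"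
      using True \<mu> by (auto simp only: I_def if_True intro!: has_integral_mult_right has_integral_gegenbauer_moment)
    then show ?thesis using True by (simp add: higher_pderiv_monom poly_monom mult.assoc)
  qed (simp add: higher_pderiv_monom I_def)
  then have "((\<lambda>u. poly (monom 1 a) u * ((u - -1) powr (real k + \<mu> - 1/2 - real k) * (1 - u) powr (real k + \<mu> - 1/2 - real k)
      * poly (rodrigues_poly (-1) 1 (real k + \<mu> - 1/2) (real k + \<mu> - 1/2) k) u)) has_integral (-1) ^ k * I) {-1..1}"
    using \<mu> by (intro rodrigues_parts) auto
  then have "((\<lambda>u. u ^ a * (?w (\<mu> - 1/2) u * poly (x_factor \<mu> k) u)) has_integral (-1) ^ k * I) {-1..1}"
    by (simp add: poly_monom x_factor_def)
  with L have "(\<Sum>c\<le>k. coeff (x_factor \<mu> k) c * gegenbauer_moment (\<mu> - 1/2) (a + c)) = (-1) ^ k * I"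
    by (rule has_integral_unique)
  then show ?thesis by (simp add: I_def)
qed

text \<open>Here \<open>b\<close> is the total degree of the monomial. Of the power
  \<open>t^(k + b)\<close>, the part \<open>t^(2k)\<close> completes the weight to the one belonging
  to \<open>t_factor\<close>, and \<open>n - k\<close> integrations by parts differentiate the
  remaining \<open>t^(b - k)\<close>. The result is zero unless \<open>b = n\<close>, and then a
  Beta integral.\<close>

lemma t_factor_moment:
  assumes "k \<le> n" "k \<le> b" "b \<le> n"
  shows "(\<Sum>e\<le>n - k. coeff (t_factor \<beta> \<gamma> \<mu> k n) e * t_moment \<beta> \<gamma> \<mu> (k + b + e)) =
    (if b = n then (-1) ^ (n - k) * fact (n - k) * Beta (real n + real k + \<beta> + 2 * \<mu> + 1) (\<gamma> + real n - real k + 1) else 0)"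
proof -
  let ?w = "\<lambda>t. (t - 0) powr (2 * \<mu> + \<beta>) * (1 - t) powr \<gamma>"
  have "((\<lambda>t. \<Sum>e\<le>n - k. coeff (t_factor \<beta> \<gamma> \<mu> k n) e * (t ^ (k + b + e) * ?w t))
    has_integral (\<Sum>e\<le>n - k. coeff (t_factor \<beta> \<gamma> \<mu> k n) e * t_moment \<beta> \<gamma> \<mu> (k + b + e))) {0..1}"
    using \<gamma> \<beta>\<mu> unfolding t_moment_def
    by (intro has_integral_sum has_integral_mult_right integrable_integral jacobi_density_integrable_on continuous_intros) auto
  then have L: "((\<lambda>t. poly (monom 1 (b - k)) t * ((t - 0) powr (real n + real k + \<beta> + 2 * \<mu> - real (n - k))
      * (1 - t) powr (\<gamma> + real n - real k - real (n - k))
      * poly (rodrigues_poly 0 1 (real n + real k + \<beta> + 2 * \<mu>) (\<gamma> + real n - real k) (n - k)) t))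
    has_integral (\<Sum>e\<le>n - k. coeff (t_factor \<beta> \<gamma> \<mu> k n) e * t_moment \<beta> \<gamma> \<mu> (k + b + e))) {0..1}"
  proof (rule has_integral_eq[rotated])
    fix t :: real assume t: "t \<in> {0..1}"
    have e: "real n + real k + \<beta> + 2 * \<mu> - real (n - k) = real (2 * k) + (2 * \<mu> + \<beta>)" "\<gamma> + real n - real k - real (n - k) = \<gamma>"
      using assms(1) by (simp_all add: of_nat_diff)
    \<comment> \<open>At \<open>t = 0\<close> both sides are 0 because \<open>0 powr _ = 0\<close>,
      whatever the sign of the exponents.\<close>
    have "t ^ (2 * k) * t powr (2 * \<mu> + \<beta>) = t powr (real (2 * k) + (2 * \<mu> + \<beta>))"
      using t by (cases "t = 0") (simp_all add: powr_add powr_realpow del: of_nat_mult)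
    moreover have "t ^ (k + b) = t ^ (b - k) * t ^ (2 * k)"
      using assms(2) by (simp flip: power_add)
    ultimately have w: "t ^ (k + b) * ?w t = t ^ (b - k) * (t powr (real (2 * k) + (2 * \<mu> + \<beta>)) * (1 - t) powr \<gamma>)"
      by (simp add: mult.assoc)
    have "(\<Sum>e\<le>n - k. coeff (t_factor \<beta> \<gamma> \<mu> k n) e * (t ^ (k + b + e) * ?w t))
      = (\<Sum>e\<le>n - k. coeff (t_factor \<beta> \<gamma> \<mu> k n) e * t ^ e) * (t ^ (k + b) * ?w t)"
      unfolding sum_distrib_right by (intro sum.cong refl) (simp add: power_add)
    also have "\<dots> = poly (monom 1 (b - k)) t * (t powr (real (2 * k) + (2 * \<mu> + \<beta>)) * (1 - t) powr \<gamma> * poly (t_factor \<beta> \<gamma> \<mu> k n) t)"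
      unfolding w poly_sum_atMost[OF degree_t_factor] by (simp add: poly_monom)
    finally show "(\<Sum>e\<le>n - k. coeff (t_factor \<beta> \<gamma> \<mu> k n) e * (t ^ (k + b + e) * ?w t)) =
      poly (monom 1 (b - k)) t * ((t - 0) powr (real n + real k + \<beta> + 2 * \<mu> - real (n - k))
      * (1 - t) powr (\<gamma> + real n - real k - real (n - k))
      * poly (rodrigues_poly 0 1 (real n + real k + \<beta> + 2 * \<mu>) (\<gamma> + real n - real k) (n - k)) t)"
      unfolding e t_factor_def by simp
  qed
  define I where "I = (if b = n then fact (n - k) * Beta (real n + real k + \<beta> + 2 * \<mu> + 1) (\<gamma> + real n - real k + 1) else 0)"
  have p: "real n + real k + \<beta> + 2 * \<mu> + 1 > 0" "\<gamma> + real n - real k + 1 > 0"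
    using assms(1) \<gamma> \<beta>\<mu> by (simp_all add: of_nat_diff)
  have "((\<lambda>t. poly ((pderiv ^^ (n - k)) (monom 1 (b - k))) t * ((t - 0) powr (real n + real k + \<beta> + 2 * \<mu>) * (1 - t) powr (\<gamma> + real n - real k)))
      has_integral I) {0..1}"
  proof (cases "b = n")
    case True
    have "((\<lambda>t. fact (n - k) * (t powr (real n + real k + \<beta> + 2 * \<mu> + 1 - 1) * (1 - t) powr (\<gamma> + real n - real k + 1 - 1))) has_integral I) {0..1}"
      using p unfolding I_def if_P[OF True] by (intro has_integral_mult_right has_integral_Beta_real)
    then show ?thesis using True by (simp add: higher_pderiv_monom poly_monom)
  next
    case False
    then have "\<not> n - k \<le> b - k" using assms by linarith
    then show ?thesis using False by (simp add: higher_pderiv_monom I_def)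
  qed
  then have "((\<lambda>t. poly (monom 1 (b - k)) t * ((t - 0) powr (real n + real k + \<beta> + 2 * \<mu> - real (n - k))
      * (1 - t) powr (\<gamma> + real n - real k - real (n - k))
      * poly (rodrigues_poly 0 1 (real n + real k + \<beta> + 2 * \<mu>) (\<gamma> + real n - real k) (n - k)) t))
    has_integral (-1) ^ (n - k) * I) {0..1}"
    using assms(1) \<gamma> \<beta>\<mu> by (intro rodrigues_parts) (auto simp: of_nat_diff)
  with L have "(\<Sum>e\<le>n - k. coeff (t_factor \<beta> \<gamma> \<mu> k n) e * t_moment \<beta> \<gamma> \<mu> (k + b + e)) = (-1) ^ (n - k) * I"
    by (rule has_integral_unique)
  then show ?thesis by (simp add: I_def)
qed

text \<open>For \<open>k, j \<le> n\<close> this is the inner product of \<open>U_poly\<close> with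
  the monomial \<open>x^j t^(n - j)\<close>. The sign combines \<open>(-1)^k\<close> and
  \<open>(-1)^(n - k)\<close> from the integrations by parts in the two variables.\<close>

definition U_moment :: "nat \<Rightarrow> nat \<Rightarrow> nat \<Rightarrow> real" where
  "U_moment n k j = (if k \<le> j then (-1) ^ n * (fact j / fact (j - k)) * fact (n - k)
     * gegenbauer_moment (real k + \<mu> - 1/2) (j - k)
     * Beta (real n + real k + \<beta> + 2 * \<mu> + 1) (\<gamma> + real n - real k + 1) else 0)"

lemma ip_U_monomial_top:
  assumes "k \<le> n" "j \<le> n"
  shows "ip (U_poly \<beta> \<gamma> \<mu> k n) (monomial_xt j (n - j)) = U_moment n k j"
proof (cases "k \<le> j")
  case True
  have "(-1::real) ^ n = (-1) ^ k * (-1) ^ (n - k)"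
    using assms(1) by (simp flip: power_add)
  moreover have "k + j + (n - j) = k + n" using assms by simp
  ultimately show ?thesis
    unfolding U_poly_eq_product_U[OF assms(1)] ip_product_U_monomial x_factor_moment
      U_moment_def
    using True t_factor_moment[OF assms(1,1) order.refl] by simp
qed (use assms in \<open>simp add: U_poly_eq_product_U ip_product_U_monomial x_factor_moment U_moment_def\<close>)

text \<open>For \<open>a < k\<close> the factor in \<open>x\<close> vanishes; for
  \<open>k \<le> a\<close> the total degree lies between \<open>k\<close> and \<open>n - 1\<close>,
  and the factor in \<open>t\<close> vanishes.\<close>

lemma ip_U_monomial_lower:
  assumes "k \<le> n" "a + b < n"
  shows "ip (U_poly \<beta> \<gamma> \<mu> k n) (monomial_xt a b) = 0"
proof (cases "k \<le> a")
  case True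
  then show ?thesis
    using assms t_factor_moment[of k n "a + b"]
    by (simp add: U_poly_eq_product_U ip_product_U_monomial add.assoc)
qed (use assms in \<open>simp add: U_poly_eq_product_U ip_product_U_monomial x_factor_moment\<close>)

lemma U_moment_nonzero:
  assumes "k \<le> n"
  shows "U_moment n k k \<noteq> 0"
proof -
  have "real n + real k + \<beta> + 2 * \<mu> + 1 > 0" "\<gamma> + real n - real k + 1 > 0"
    using assms \<gamma> \<beta>\<mu> by (simp_all add: of_nat_diff)
  then have "Beta (real n + real k + \<beta> + 2 * \<mu> + 1) (\<gamma> + real n - real k + 1) > 0"
    by (simp add: Beta_def Gamma_real_pos)
  moreover have "gegenbauer_moment (real k + \<mu> - 1/2) 0 > 0"
    using \<mu> by (intro gegenbauer_moment_pos) auto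
  ultimately show ?thesis by (simp add: U_moment_def)
qed

lemma U_moment_odd:
  assumes "odd (j - k)"
  shows "U_moment n k j = 0"
  using assms \<mu> gegenbauer_moment_odd[of "real k + \<mu> - 1/2"] by (simp add: U_moment_def)

text \<open>The origin of the coefficients \<open>d_coeff\<close>: they are the ratios of an
  off-diagonal moment to the diagonal moment of the same monomial.\<close>

lemma U_moment_even:
  assumes "k + 2 * i \<le> n"
  shows "U_moment n k (k + 2 * i) = d_coeff \<beta> \<gamma> \<mu> n i (n - k) * U_moment n (k + 2 * i) (k + 2 * i)"
proof -
  define c where "c = real k + \<mu> - 1/2"
  define m where "m = n - k - 2 * i"
  \<comment> \<open>Passing from index \<open>k\<close> to \<open>k + 2 * i\<close> replaces
    \<open>Beta X (Y + 2i)\<close> by \<open>Beta (X + 2i) Y\<close>. The sum of the arguments is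
    unchanged, so the common denominator \<open>S\<close> cancels.\<close>
  define X where "X = real n + real k + \<beta> + 2 * \<mu> + 1"
  define Y where "Y = \<gamma> + real m + 1"
  have n: "n = k + 2 * i + m" using assms by (simp add: m_def)
  have c: "c > -1" using \<mu> by (simp add: c_def)
  have X: "X > 0" using \<beta>\<mu> by (simp add: X_def)
  have Y: "Y > 0" using \<gamma> by (simp add: Y_def)
  define g where "g = gegenbauer_moment c 0"
  define p1 where "p1 = pochhammer (c + 1) (2 * i)"
  define q1 where "q1 = pochhammer (c + 3/2) i"
  define q2 where "q2 = pochhammer (c + 3/2 + real i) i"
  define h where "h = pochhammer (1/2 :: real) i"
  define pX where "pX = pochhammer X (2 * i)"
  define pY where "pY = pochhammer Y (2 * i)"
  define gX where "gX = Gamma X"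
  define gY where "gY = Gamma Y"
  have pos: "g > 0" "p1 > 0" "q1 > 0" "q2 > 0" "pX > 0" "pY > 0" "gX > 0" "gY > 0" "h > 0"
    using c X Y by (simp_all add: g_def p1_def q1_def q2_def pX_def pY_def gX_def gY_def h_def
      pochhammer_pos gegenbauer_moment_pos Gamma_real_pos)
  have g1: "gegenbauer_moment c (2 * i) = h / q1 * g"
    using gegenbauer_moment_even[OF c] by (simp add: g_def h_def q1_def)
  \<comment> \<open>In the ratio \<open>q1\<close> cancels, and \<open>q2\<close> is the factor of
    \<open>d_coeff\<close> of length \<open>i\<close>.\<close>
  have "pochhammer (c + 3/2) (2 * i) = q1 * q2"
    unfolding mult_2 q1_def q2_def by (rule pochhammer_product')
  then have g2: "gegenbauer_moment (c + real (2 * i)) 0 = p1 / (q1 * q2) * g"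
    using gegenbauer_moment_shift[OF c, of "2 * i"] by (simp only: g_def p1_def)
  have "Gamma X \<noteq> 0" "Gamma Y \<noteq> 0"
    using Gamma_real_pos[OF X] Gamma_real_pos[OF Y] by linarith+
  have GX: "Gamma (X + real (2 * i)) = pX * gX"
    using pochhammer_Gamma[of X "2 * i"] X \<open>Gamma X \<noteq> 0\<close> by (simp add: pX_def gX_def nonpos_Ints_def)
  have GY: "Gamma (Y + real (2 * i)) = pY * gY"
    using pochhammer_Gamma[of Y "2 * i"] Y \<open>Gamma Y \<noteq> 0\<close> by (simp add: pY_def gY_def nonpos_Ints_def)
  \<comment> \<open>The duplication formula: its factor \<open>h\<close> cancels against the
    numerator of the even Gegenbauer moment and leaves the \<open>2 ^ (2 * i) * fact i\<close> of
    \<open>d_coeff\<close>.\<close>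
  have f2: "fact (2 * i) = (2 ^ (2 * i) * h * fact i :: real)"
    using fact_double[of i] by (simp add: h_def)
  define S where "S = Gamma (X + Y + real (2 * i))"
  have S: "S > 0" using X Y by (simp add: S_def Gamma_real_pos)
  have "U_moment n k (k + 2 * i) = (-1) ^ n * (fact (k + 2 * i) / fact (2 * i)) * fact (m + 2 * i)
     * gegenbauer_moment c (2 * i) * Beta X (Y + real (2 * i))"
    by (simp add: U_moment_def c_def X_def Y_def n add_ac)
  also have "\<dots> = (-1) ^ n * (fact (k + 2 * i) / (2 ^ (2 * i) * h * fact i)) * fact (m + 2 * i)
     * (h / q1 * g) * (gX * (pY * gY) / S)"
    by (simp only: f2 g1 Beta_def GY gX_def S_def add.assoc)
  finally have L: "U_moment n k (k + 2 * i) = (-1) ^ n * (fact (k + 2 * i) / (2 ^ (2 * i) * h * fact i)) * fact (m + 2 * i)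
     * (h / q1 * g) * (gX * (pY * gY) / S)" .
  have "U_moment n (k + 2 * i) (k + 2 * i) = (-1) ^ n * fact (k + 2 * i) * fact m
     * gegenbauer_moment (c + real (2 * i)) 0 * Beta (X + real (2 * i)) Y"
    by (simp add: U_moment_def c_def X_def Y_def n add_ac algebra_simps)
  also have "\<dots> = (-1) ^ n * fact (k + 2 * i) * fact m * (p1 / (q1 * q2) * g) * (pX * gX * gY / S)"
    by (simp only: g2 Beta_def GX gY_def S_def add_ac)
  finally have R: "U_moment n (k + 2 * i) (k + 2 * i) = (-1) ^ n * fact (k + 2 * i) * fact m * (p1 / (q1 * q2) * g) * (pX * gX * gY / S)" .
  have a: "n - k = m + 2 * i" "n - k - 2 * i = m" by (simp_all add: n)
  have b: "\<mu> + real i + real n - real (m + 2 * i) + 1 = c + 3/2 + real i"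
    "\<gamma> + real (m + 2 * i) - 2 * real i + 1 = Y"
    "\<mu> + real n - real (m + 2 * i) + 1/2 = c + 1"
    "2 * \<mu> + \<beta> + 2 * real n - real (m + 2 * i) + 1 = X"
    by (simp_all add: n c_def Y_def X_def)
  have D: "d_coeff \<beta> \<gamma> \<mu> n i (n - k) = (fact (m + 2 * i) * q2 * pY) / (2 ^ (2 * i) * fact m * fact i * p1 * pX)"
    unfolding d_coeff_def a b by (simp add: q2_def pY_def p1_def pX_def)
  show ?thesis
    unfolding L R D using pos S by (simp add: field_simps)
qed

end

subsection \<open>Biorthogonality\<close>

lemma finite_monomials_less: "finite {monomial_xt i j | i j. i + j < n}"
proof (rule finite_subset)
  show "{monomial_xt i j | i j. i + j < n} \<subseteq> (\<lambda>(i, j). monomial_xt i j) ` ({..n} \<times> {..n})"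
  proof clarify
    fix i j assume "i + j < n"
    then have "(i, j) \<in> {..n} \<times> {..n}" by simp
    then show "monomial_xt i j \<in> (\<lambda>(i, j). monomial_xt i j) ` ({..n} \<times> {..n})"
      by (metis (mono_tags, lifting) image_eqI prod.case)
  qed
qed simp

section \<open>Orthogonal projection and the polynomials \<open>V_poly\<close>\<close>

context cone_jacobi
begin

lemma ip_span_eq_0:
  assumes "f \<in> plane_polys" "B \<subseteq> plane_polys" "\<And>b. b \<in> B \<Longrightarrow> ip b f = 0" "g \<in> fun_vs.span B"
  shows "ip g f = 0"
proof -
  have "g \<in> plane_polys \<and> ip g f = 0"
    using assms(4)
  proof (induction rule: fun_vs.span_induct_alt)
    case base
    show ?case using ip_zero fun_vs.span_zero by (simp only: plane_polys_def)
  next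
    case (step c x y)
    then have "x \<in> plane_polys" using assms(2) by auto
    then have "ip ((\<lambda>p. c * x p) + y) f = c * ip x f + ip y f"
      using step assms(1) unfolding ip_scale[symmetric] by (intro ip_add plane_polys_scale) auto
    then show ?case
      using step assms(3) \<open>x \<in> plane_polys\<close> by (auto intro!: plane_polys_add plane_polys_scale simp del: plus_fun_apply)
  qed
  then show ?thesis ..
qed

text \<open>One Gram-Schmidt step per element: \<open>b' = b - pb\<close> is orthogonal to the span
  of \<open>B\<close>, and the projection of \<open>f\<close> onto that span is corrected by the
  component of \<open>f\<close> along \<open>b'\<close>.\<close>

lemma orthogonal_projection:
  assumes "finite B" "B \<subseteq> plane_polys" "f \<in> plane_polys"
  shows "\<exists>p\<in>fun_vs.span B. \<forall>g\<in>fun_vs.span B. ip (f - p) g = 0"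
  using assms
proof (induction B arbitrary: f rule: finite_induct)
  case empty
  have "ip (f - 0) 0 = 0" using ip_commute ip_zero by metis
  then show ?case by (simp only: fun_vs.span_empty) blast
next
  case (insert b B)
  then have BP: "B \<subseteq> plane_polys" and bP: "b \<in> plane_polys" by auto
  have spanP: "fun_vs.span (insert b B) \<subseteq> plane_polys"
    using insert.prems unfolding plane_polys_def by (intro fun_vs.span_minimal fun_vs.subspace_span) auto
  have span_sub: "fun_vs.span B \<subseteq> fun_vs.span (insert b B)"
    by (rule fun_vs.span_mono) auto
  obtain pf where pf: "pf \<in> fun_vs.span B" "\<And>g. g \<in> fun_vs.span B \<Longrightarrow> ip (f - pf) g = 0"
    using insert.IH[OF BP insert.prems(2)] by blast
  obtain pb where pb: "pb \<in> fun_vs.span B" "\<And>g. g \<in> fun_vs.span B \<Longrightarrow> ip (b - pb) g = 0"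
    using insert.IH[OF BP bP] by blast
  define b' where "b' = b - pb"
  have b'S: "b' \<in> fun_vs.span (insert b B)"
    unfolding b'_def using pb(1) span_sub by (intro fun_vs.span_diff fun_vs.span_base[of b]) auto
  then have b'P: "b' \<in> plane_polys" using spanP by blast
  have pfP: "pf \<in> plane_polys" using pf span_sub spanP by blast
  define c where "c = ip f b' / ip b' b'"
  \<comment> \<open>If \<open>b\<close> already lies in the span of \<open>B\<close>, then
    \<open>b'\<close> may be 0 and \<open>c\<close> is 0 by division by zero; the equation still
    holds, so linear independence need not be assumed.\<close>
  have c: "c * ip b' b' = ip f b'"
  proof (cases "ip b' b' = 0")
    case True
    then have "b' = 0" by (rule ip_definite[OF b'P])
    then show ?thesis using True ip_commute[of f] ip_zero by simp
  qed (simp add: c_def)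
  define p where "p = pf + (\<lambda>q. c * b' q)"
  have pS: "p \<in> fun_vs.span (insert b B)"
    unfolding p_def using pf(1) span_sub b'S by (intro fun_vs.span_add fun_vs.span_scale) auto
  have fp: "ip (f - p) g = ip (f - pf) g - c * ip b' g" if "g \<in> plane_polys" for g
  proof -
    have "f - p = (f - pf) - (\<lambda>q. c * b' q)" by (simp add: p_def fun_eq_iff)
    then show ?thesis
      using that insert.prems pfP b'P by (simp only: ip_diff[OF plane_polys_diff plane_polys_scale] ip_scale)
  qed
  have "ip pf b' = 0"
    using pb(2)[OF pf(1)] ip_commute by (simp add: b'_def)
  then have ob: "ip (f - p) b' = 0"
    using fp[OF b'P] c ip_diff[OF insert.prems(2) pfP b'P] by simp
  have "ip (f - p) g = 0" if g: "g \<in> fun_vs.span (insert b B)" for g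
  proof -
    obtain k where k: "g - (\<lambda>q. k * b q) \<in> fun_vs.span B"
      using fun_vs.span_breakdown[of b "insert b B" g] g insert.hyps by auto
    define s where "s = (g - (\<lambda>q. k * b q)) + (\<lambda>q. k * pb q)"
    have sS: "s \<in> fun_vs.span B"
      unfolding s_def using k pb(1) by (intro fun_vs.span_add fun_vs.span_scale)
    then have sP: "s \<in> plane_polys" using span_sub spanP by blast
    have g: "g = (\<lambda>q. k * b' q) + s"
      by (simp add: fun_eq_iff s_def b'_def algebra_simps)
    have fpP: "f - p \<in> plane_polys"
      using insert.prems pS spanP by (intro plane_polys_diff) auto
    have "ip g (f - p) = k * ip b' (f - p) + ip s (f - p)"
      unfolding g using b'P sP fpP by (simp only: ip_add[OF plane_polys_scale] ip_scale)
    moreover have "ip (f - p) s = 0"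
      using fp[OF sP] pf(2)[OF sS] pb(2)[OF sS] by (simp add: b'_def)
    ultimately show ?thesis using ob by (simp add: ip_commute)
  qed
  with pS show ?case by blast
qed

abbreviation "orth \<equiv> orth_polys \<beta> \<gamma> \<mu>"

lemma orth_plane: "f \<in> orth n \<Longrightarrow> f \<in> plane_polys"
  using polys_le_subset by (auto simp: orth_polys_def)

lemma subspace_orth: "fun_vs.subspace (orth n)"
proof -
  have "fun_vs.subspace (polys_le n)"
    unfolding polys_le_def by (rule fun_vs.subspace_span)
  then show ?thesis
    unfolding fun_vs.subspace_def orth_polys_def
    using polys_le_subset[of n] polys_less_subset[of n]
    by (auto simp only: mem_Collect_eq ip_zero ip_scale mult_zero_right
        intro!: trans[OF ip_add] add_0_left)
qed

text \<open>Such an \<open>f\<close> is orthogonal to itself.\<close>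

lemma orth_less_eq_0:
  assumes "f \<in> orth n" "f \<in> polys_less n"
  shows "f = 0"
  using assms orth_plane by (intro ip_definite) (auto simp: orth_polys_def)

text \<open>Existence: subtract from the monomial its projection onto lower degree. Uniqueness: the
  difference of two candidates has lower degree and is orthogonal to lower degree.\<close>

lemma V_poly_exists:
  assumes "k \<le> n"
  shows "\<exists>!f. f \<in> orth n \<and> f - monomial_xt k (n - k) \<in> polys_less n"
proof -
  let ?m = "monomial_xt k (n - k)"
  have "{monomial_xt i j | i j. i + j < n} \<subseteq> plane_polys"
    using monomial_xt_plane by auto
  from orthogonal_projection[OF finite_monomials_less this monomial_xt_plane]
  obtain p where p: "p \<in> polys_less n" "\<And>g. g \<in> polys_less n \<Longrightarrow> ip (?m - p) g = 0"
    unfolding polys_less_def by blast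
  have "k + (n - k) \<le> n" using assms by simp
  then have "?m \<in> polys_le n"
    unfolding polys_le_def by (intro fun_vs.span_base) blast
  then have "?m - p \<in> polys_le n"
    using p(1) polys_less_subset_le unfolding polys_le_def by (intro fun_vs.span_diff) blast+
  then have "?m - p \<in> orth n"
    using p(2) by (simp add: orth_polys_def)
  moreover have "(?m - p) - ?m \<in> polys_less n"
  proof -
    have "(?m - p) - ?m = - p" by (simp add: fun_eq_iff)
    moreover have "- p \<in> polys_less n" using p(1) unfolding polys_less_def by (rule fun_vs.span_neg)
    ultimately show ?thesis by (simp only:)
  qed
  moreover have "f = g" if f: "f \<in> orth n" "f - ?m \<in> polys_less n" and g: "g \<in> orth n" "g - ?m \<in> polys_less n" for f g
  proof -
    have "(f - ?m) - (g - ?m) \<in> polys_less n"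
      using f(2) g(2) unfolding polys_less_def by (rule fun_vs.span_diff)
    moreover have "(f - ?m) - (g - ?m) = f - g" by (simp add: fun_eq_iff)
    ultimately have "f - g \<in> polys_less n" by (simp only:)
    moreover have "f - g \<in> orth n"
      using f g by (intro fun_vs.subspace_diff[OF subspace_orth])
    ultimately have "f - g = 0" by (intro orth_less_eq_0)
    then show ?thesis by (simp only: right_minus_eq)
  qed
  ultimately show ?thesis by blast
qed

lemma V_poly_props:
  assumes "k \<le> n"
  shows "V_poly \<beta> \<gamma> \<mu> k n \<in> orth n" "V_poly \<beta> \<gamma> \<mu> k n - monomial_xt k (n - k) \<in> polys_less n"
  using theI'[OF V_poly_exists[OF assms]] by (simp_all add: V_poly_def)

text \<open>The \<open>V_poly\<close> and the monomials of lower degree together span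
  \<open>polys_le n\<close>. The lower-degree component of an element of \<open>orth n\<close> is
  itself in \<open>orth n\<close>, hence zero.\<close>

lemma orth_subset_span_V: "orth n \<subseteq> fun_vs.span ((\<lambda>k. V_poly \<beta> \<gamma> \<mu> k n) ` {0..n})"
proof
  let ?V = "(\<lambda>k. V_poly \<beta> \<gamma> \<mu> k n) ` {0..n}" and ?L = "{monomial_xt i j | i j. i + j < n}"
  fix f assume f: "f \<in> orth n"
  have "{monomial_xt i j | i j. i + j \<le> n} \<subseteq> fun_vs.span (?V \<union> ?L)"
  proof clarify
    fix i j assume ij: "i + j \<le> n"
    show "monomial_xt i j \<in> fun_vs.span (?V \<union> ?L)"
    proof (cases "i + j < n")
      case True
      then show ?thesis by (intro fun_vs.span_base) blast
    next
      case False
      then have j: "j = n - i" "i \<le> n" using ij by auto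
      have "V_poly \<beta> \<gamma> \<mu> i n - monomial_xt i j \<in> fun_vs.span (?V \<union> ?L)"
        using V_poly_props(2)[OF j(2)] fun_vs.span_mono[of ?L "?V \<union> ?L"]
        unfolding j(1) polys_less_def by blast
      moreover have "V_poly \<beta> \<gamma> \<mu> i n \<in> fun_vs.span (?V \<union> ?L)"
        using j(2) by (intro fun_vs.span_base) auto
      ultimately have "V_poly \<beta> \<gamma> \<mu> i n - (V_poly \<beta> \<gamma> \<mu> i n - monomial_xt i j) \<in> fun_vs.span (?V \<union> ?L)"
        by (rule fun_vs.span_diff[rotated])
      moreover have "V_poly \<beta> \<gamma> \<mu> i n - (V_poly \<beta> \<gamma> \<mu> i n - monomial_xt i j) = monomial_xt i j"
        by (simp add: fun_eq_iff)
      ultimately show ?thesis by (simp only:)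
    qed
  qed
  then have "polys_le n \<subseteq> fun_vs.span (?V \<union> ?L)"
    unfolding polys_le_def by (intro fun_vs.span_minimal fun_vs.subspace_span)
  then have "f \<in> fun_vs.span (?V \<union> ?L)"
    using f by (auto simp: orth_polys_def)
  then obtain v l where f_eq: "f = v + l" and v: "v \<in> fun_vs.span ?V" and l: "l \<in> polys_less n"
    unfolding fun_vs.span_Un polys_less_def by blast
  have "fun_vs.span ?V \<subseteq> orth n"
    using V_poly_props(1) by (intro fun_vs.span_minimal subspace_orth) auto
  then have "f - v \<in> orth n"
    using f v by (intro fun_vs.subspace_diff[OF subspace_orth]) auto
  moreover have "f - v = l" by (simp add: f_eq fun_eq_iff)
  ultimately have "l = 0" using l orth_less_eq_0 by blast
  then show "f \<in> fun_vs.span ?V" using f_eq v by (simp only: add_0_right)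
qed

text \<open>Independence comes from pairing with the dual family, and the spanning property of
  \<open>y\<close> from the dual expansion, so no dimension count is made.\<close>

lemma biorthogonal_basis:
  assumes I: "finite I" and S: "fun_vs.subspace S" "S \<subseteq> plane_polys"
    and y: "\<And>k. k \<in> I \<Longrightarrow> y k \<in> S" and v: "\<And>k. k \<in> I \<Longrightarrow> v k \<in> S" "S \<subseteq> fun_vs.span (v ` I)"
    and orth: "\<And>k j. k \<in> I \<Longrightarrow> j \<in> I \<Longrightarrow> k \<noteq> j \<Longrightarrow> ip (y k) (v j) = 0"
    and diag: "\<And>k. k \<in> I \<Longrightarrow> ip (y k) (v k) \<noteq> 0"
  shows "is_basis_family I y S \<and> is_basis_family I v S"
proof -
  \<comment> \<open>Stated for arbitrary families, since it is used twice with the roles of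
    \<open>y\<close> and \<open>v\<close> exchanged.\<close>
  have indep: "inj_on y I \<and> fun_vs.independent (y ` I)"
    if y: "\<And>k. k \<in> I \<Longrightarrow> y k \<in> plane_polys" and v: "\<And>k. k \<in> I \<Longrightarrow> v k \<in> plane_polys"
      and orth: "\<And>k j. k \<in> I \<Longrightarrow> j \<in> I \<Longrightarrow> k \<noteq> j \<Longrightarrow> ip (y k) (v j) = 0"
      and diag: "\<And>k. k \<in> I \<Longrightarrow> ip (y k) (v k) \<noteq> 0" for y v
  proof
    show "inj_on y I" using orth diag by (metis inj_onI)
    show "fun_vs.independent (y ` I)"
      unfolding fun_vs.dependent_def
    proof clarify
      fix k assume k: "k \<in> I" and dep: "y k \<in> fun_vs.span (y ` I - {y k})"
      have "ip (y k) (v k) = 0"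
        using dep
      proof (rule ip_span_eq_0[rotated 3])
        fix b assume "b \<in> y ` I - {y k}"
        then obtain j where "j \<in> I" "b = y j" "j \<noteq> k" by auto
        then show "ip b (v k) = 0" using orth k by simp
      qed (use v y k in auto)
      with diag[OF k] show False ..
    qed
  qed
  have "fun_vs.span (y ` I) = S"
  proof
    show "fun_vs.span (y ` I) \<subseteq> S"
      using y S(1) by (intro fun_vs.span_minimal) auto
    show "S \<subseteq> fun_vs.span (y ` I)"
    proof
      fix f assume f: "f \<in> S"
      \<comment> \<open>The biorthogonal expansion of \<open>f\<close>: the remainder
        \<open>f - h\<close> is orthogonal to every \<open>v j\<close>, hence to all of
        \<open>S\<close>, hence to itself.\<close>
      define h where "h = (\<Sum>k\<in>I. (\<lambda>p. ip f (v k) / ip (y k) (v k) * y k p))"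
      have hy: "h \<in> fun_vs.span (y ` I)"
        unfolding h_def by (intro fun_vs.span_sum fun_vs.span_scale fun_vs.span_base) auto
      have hS: "h \<in> S"
        using hy y S(1) fun_vs.span_minimal[of "y ` I" S] by blast
      have "ip h (v j) = ip f (v j)" if j: "j \<in> I" for j
      proof -
        have "ip h (v j) = (\<Sum>k\<in>I. ip (\<lambda>p. ip f (v k) / ip (y k) (v k) * y k p) (v j))"
          unfolding h_def using y v S(2) j by (intro ip_sum plane_polys_scale) auto
        also have "\<dots> = (\<Sum>k\<in>I. if k = j then ip f (v k) else 0)"
          unfolding ip_scale using orth diag j by (intro sum.cong) auto
        finally show ?thesis using I j by simp
      qed
      then have z: "ip (v j) (f - h) = 0" if "j \<in> I" for j
        using that ip_diff[of f h "v j"] f hS v(1)[OF that] S(2) ip_commute[of "v j"] by (simp add: subset_iff)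
      have fh: "f - h \<in> S" using f hS by (intro fun_vs.subspace_diff[OF S(1)])
      have "ip (f - h) (f - h) = 0"
        by (rule ip_span_eq_0[where B = "v ` I"]) (use fh S(2) v z in auto)
      then have "f - h = 0" using fh S(2) by (intro ip_definite) auto
      then have "f = h" by (simp only: right_minus_eq)
      then show "f \<in> fun_vs.span (y ` I)" using hy by simp
    qed
  qed
  moreover have "fun_vs.span (v ` I) = S"
    using v S(1) by (intro antisym fun_vs.span_minimal) auto
  moreover have "inj_on y I \<and> fun_vs.independent (y ` I)"
    using y v S(2) orth diag by (intro indep[of y v]) auto
  moreover have "inj_on v I \<and> fun_vs.independent (v ` I)"
    using y v S(2) orth diag by (intro indep[of v y]) (auto simp: ip_commute[of "v _"])
  ultimately show ?thesis by (simp add: is_basis_family_def)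
qed

lemma U_poly_orth:
  assumes "k \<le> n"
  shows "U_poly \<beta> \<gamma> \<mu> k n \<in> orth n"
proof -
  have le: "U_poly \<beta> \<gamma> \<mu> k n \<in> polys_le n"
    using assms by (simp add: U_poly_eq_product_U product_U_polys_le)
  moreover have "ip (U_poly \<beta> \<gamma> \<mu> k n) g = 0" if "g \<in> polys_less n" for g
  proof -
    have "ip g (U_poly \<beta> \<gamma> \<mu> k n) = 0"
      using that unfolding polys_less_def
    proof (rule ip_span_eq_0[rotated 3])
      fix b assume "b \<in> {monomial_xt i j | i j. i + j < n}"
      then show "ip b (U_poly \<beta> \<gamma> \<mu> k n) = 0"
        using ip_U_monomial_lower[OF assms] ip_commute by auto
    qed (use le polys_le_subset monomial_xt_plane in auto)
    then show ?thesis by (simp add: ip_commute)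
  qed
  ultimately show ?thesis by (simp add: orth_polys_def)
qed

text \<open>Strong induction downwards from \<open>m = n\<close>. By hypothesis each
  \<open>Y_poly\<close> of index \<open>m + 2 * i\<close> has a single nonzero moment, so
  subtracting it \<open>d_coeff\<close> times removes the moment of \<open>U_poly\<close> at
  \<open>j = m + 2 * i\<close> and changes no other.\<close>

lemma Y_poly_moment:
  assumes "m \<le> n"
  shows "Y_poly \<beta> \<gamma> \<mu> m n \<in> orth n
    \<and> (\<forall>j\<le>n. ip (Y_poly \<beta> \<gamma> \<mu> m n) (monomial_xt j (n - j)) = (if j = m then U_moment n m m else 0))"
  using assms
proof (induction "n - m" arbitrary: m rule: less_induct)
  case less
  define D where "D i = d_coeff \<beta> \<gamma> \<mu> n i (n - m)" for i
  define I where "I = {1..(n - m) div 2}"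
  have I: "m + 2 * i \<le> n \<and> 0 < i \<longleftrightarrow> i \<in> I" for i
    using less.prems by (auto simp: I_def)
  have IH: "Y_poly \<beta> \<gamma> \<mu> (m + 2 * i) n \<in> orth n"
    "j \<le> n \<Longrightarrow> ip (Y_poly \<beta> \<gamma> \<mu> (m + 2 * i) n) (monomial_xt j (n - j)) =
      (if j = m + 2 * i then U_moment n (m + 2 * i) (m + 2 * i) else 0)" if "i \<in> I" for i j
    using less.hyps[of "m + 2 * i"] I[of i] that less.prems by auto
  have DU: "D i * U_moment n (m + 2 * i) (m + 2 * i) = U_moment n m (m + 2 * i)" if "i \<in> I" for i
    using U_moment_even[of m i n] I[of i] that by (auto simp: D_def)
  \<comment> \<open>Both branches of the recursion take this form, because \<open>I\<close> is empty
    when \<open>n - m < 2\<close>.\<close>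
  have Y: "Y_poly \<beta> \<gamma> \<mu> m n = U_poly \<beta> \<gamma> \<mu> m n - (\<Sum>i\<in>I. (\<lambda>p. D i * Y_poly \<beta> \<gamma> \<mu> (m + 2 * i) n p))"
  proof (cases "n - m < 2")
    case True
    then have "I = {}" by (auto simp: I_def)
    with True show ?thesis by (subst Y_poly.simps) simp
  next
    case False
    then show ?thesis
      by (subst Y_poly.simps) (simp add: fun_eq_iff sum_fun_apply D_def I_def)
  qed
  have sum_orth: "(\<Sum>i\<in>I. (\<lambda>p. D i * Y_poly \<beta> \<gamma> \<mu> (m + 2 * i) n p)) \<in> orth n"
    using IH(1) by (intro fun_vs.subspace_sum fun_vs.subspace_scale subspace_orth)
  have "ip (Y_poly \<beta> \<gamma> \<mu> m n) (monomial_xt j (n - j)) = (if j = m then U_moment n m m else 0)" if j: "j \<le> n" for j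
  proof -
    have "ip (Y_poly \<beta> \<gamma> \<mu> m n) (monomial_xt j (n - j)) = U_moment n m j
      - ip (\<Sum>i\<in>I. (\<lambda>p. D i * Y_poly \<beta> \<gamma> \<mu> (m + 2 * i) n p)) (monomial_xt j (n - j))"
      unfolding Y ip_U_monomial_top[OF less.prems j, symmetric]
      using less.prems sum_orth U_poly_orth orth_plane monomial_xt_plane by (intro ip_diff) auto
    also have "ip (\<Sum>i\<in>I. (\<lambda>p. D i * Y_poly \<beta> \<gamma> \<mu> (m + 2 * i) n p)) (monomial_xt j (n - j))
      = (\<Sum>i\<in>I. ip (\<lambda>p. D i * Y_poly \<beta> \<gamma> \<mu> (m + 2 * i) n p) (monomial_xt j (n - j)))"
      using IH(1) orth_plane monomial_xt_plane by (intro ip_sum plane_polys_scale) auto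
    also have "\<dots> = (\<Sum>i\<in>I. if j = m + 2 * i then U_moment n m j else 0)"
      unfolding ip_scale using IH(2)[OF _ j] DU by (intro sum.cong refl) simp
    also have "U_moment n m j - \<dots> = (if j = m then U_moment n m m else 0)"
    proof (cases "\<exists>i\<in>I. j = m + 2 * i")
      case True
      then obtain i where i: "i \<in> I" "j = m + 2 * i" by blast
      then have "(\<Sum>i\<in>I. if j = m + 2 * i then U_moment n m j else 0) = (\<Sum>i'\<in>I. if i = i' then U_moment n m j else 0)"
        by (intro sum.cong) auto
      also have "\<dots> = U_moment n m j" using i by (simp add: I_def)
      finally show ?thesis using i I by auto
    next
      case False
      then have "(\<Sum>i\<in>I. if j = m + 2 * i then U_moment n m j else 0) = 0"
        by (intro sum.neutral) auto
      moreover have "U_moment n m j = 0" if "j \<noteq> m"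
      proof (cases "j < m")
        case True
        then show ?thesis by (simp add: U_moment_def)
      next
        case ge: False
        \<comment> \<open>Every \<open>j > m\<close> of the same parity as \<open>m\<close> is some
          \<open>m + 2 * i\<close> with \<open>i \<in> I\<close>, so only odd distances are left,
          where the Gegenbauer moment vanishes.\<close>
        have "odd (j - m)"
        proof
          assume "even (j - m)"
          then obtain i where "j - m = 2 * i" by blast
          then have "j = m + 2 * i" "0 < i" using ge \<open>j \<noteq> m\<close> by auto
          with False I[of i] j show False by auto
        qed
        then show ?thesis by (rule U_moment_odd)
      qed
      ultimately show ?thesis by simp
    qed
    finally show ?thesis .
  qed
  moreover have "Y_poly \<beta> \<gamma> \<mu> m n \<in> orth n"
    unfolding Y using less.prems sum_orth U_poly_orth by (intro fun_vs.subspace_diff subspace_orth)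
  ultimately show ?case by blast
qed

lemma ip_Y_V:
  assumes "k \<le> n" "j \<le> n"
  shows "ip (Y_poly \<beta> \<gamma> \<mu> k n) (V_poly \<beta> \<gamma> \<mu> j n) = (if j = k then U_moment n k k else 0)"
proof -
  let ?Y = "Y_poly \<beta> \<gamma> \<mu> k n" and ?V = "V_poly \<beta> \<gamma> \<mu> j n" and ?m = "monomial_xt j (n - j)"
  have "ip (?V - ?m) ?Y = ip ?V ?Y - ip ?m ?Y"
    using Y_poly_moment[OF assms(1)] V_poly_props[OF assms(2)] orth_plane monomial_xt_plane
    by (intro ip_diff) auto
  moreover have "ip ?Y (?V - ?m) = 0"
    using Y_poly_moment[OF assms(1)] V_poly_props(2)[OF assms(2)]
    unfolding orth_polys_def by blast
  ultimately have "ip ?Y ?V = ip ?Y ?m"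
    unfolding ip_commute[of "?V - ?m"] ip_commute[of ?V] ip_commute[of ?m] by linarith
  then show ?thesis using Y_poly_moment[OF assms(1)] assms(2) by simp
qed

end

theorem proposition4p8:
  fixes \<beta> \<gamma> \<mu> :: real and n :: nat
  assumes "\<mu> > -1/2" and "\<beta> > -1" and "\<gamma> > -1" and "2 * \<mu> + \<beta> + 1 > 0"
  shows "is_basis_family {0..n} (\<lambda>k. Y_poly \<beta> \<gamma> \<mu> k n) (orth_polys \<beta> \<gamma> \<mu> n)
    \<and> is_basis_family {0..n} (\<lambda>k. V_poly \<beta> \<gamma> \<mu> k n) (orth_polys \<beta> \<gamma> \<mu> n)
    \<and> (\<forall>k\<in>{0..n}. \<forall>j\<in>{0..n}.
          (k \<noteq> j \<longrightarrow> jacobi_ip \<beta> \<gamma> \<mu> (Y_poly \<beta> \<gamma> \<mu> k n) (V_poly \<beta> \<gamma> \<mu> j n) = 0)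
        \<and> (k = j \<longrightarrow> jacobi_ip \<beta> \<gamma> \<mu> (Y_poly \<beta> \<gamma> \<mu> k n) (V_poly \<beta> \<gamma> \<mu> j n) \<noteq> 0))"
proof -
  interpret cone_jacobi \<beta> \<gamma> \<mu>
    using assms by unfold_locales auto
  have "is_basis_family {0..n} (\<lambda>k. Y_poly \<beta> \<gamma> \<mu> k n) (orth_polys \<beta> \<gamma> \<mu> n)
    \<and> is_basis_family {0..n} (\<lambda>k. V_poly \<beta> \<gamma> \<mu> k n) (orth_polys \<beta> \<gamma> \<mu> n)"
    using Y_poly_moment V_poly_props(1) orth_subset_span_V ip_Y_V U_moment_nonzero
    by (intro biorthogonal_basis subspace_orth) (auto simp: orth_plane)
  then show ?thesis using ip_Y_V U_moment_nonzero by auto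
qed

end
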